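(* Let $\mathbf{S}_1,\dots,\mathbf{S}_n$ be independent random self-adjoint $d\times d$ matrices (real or complex), let $\mathbf{X}=\sum_{i=1}^n \mathbf{S}_i$, and let $\mathbf{Z}$ be a Gaussian self-adjoint $d\times d$ matrix with $\mathbb{E}[\mathbf{Z}]=\mathbb{E}[\mathbf{X}]$ and $\mathrm{Var}_{\otimes}[\mathbf{Z}]=\mathrm{Var}_{\otimes}[\mathbf{X}]$. Then $$|G_\zeta(\mathbf{X})-G_\zeta(\mathbf{Z})|\le \frac{4\,\sigma^2(\mathbf{X})\,L(\mathbf{X})}{|\mathrm{Im}\,\zeta|^4}\quad\text{for each }\zeta\in\mathbb{C}\setminus\mathbb{R}.$$
   Context: A random self-adjoint matrix $\mathbf{Z}$ is Gaussian when the real and imaginary parts of its entries form a jointly Gaussian family of real random variables. The variance tensor is $\mathrm{Var}_{\otimes}[\mathbf{Y}]=\mathbb{E}[(\mathbf{Y}-\mathbb{E}\mathbf{Y})\otimes(\mathbf{Y}-\mathbb{E}\mathbf{Y})]$, with $\otimes$ the Kronecker product. Write $\|\cdot\|$ for the spectral norm and $\mathrm{tr}[\mathbf{A}]=d^{-1}\sum_i a_{ii}$ for the normalized trace. The Cauchy transform of a random self-adjoint matrix $\mathbf{Y}$ is $G_\zeta(\mathbf{Y})=\mathbb{E}\,\mathrm{tr}[(\zeta\mathbf{I}_d-\mathbf{Y})^{-1}]$ for $\zeta\in\mathbb{C}\setminus\mathbb{R}$. Matrix variance: $\sigma^2(\mathbf{X})=\|\mathbb{E}[(\mathbf{X}-\mathbb{E}\mathbf{X})^2]\|=\big\|\sum_{i=1}^n\mathbb{E}[(\mathbf{S}_i-\mathbb{E}\mathbf{S}_i)^2]\big\|$.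 Uniform bound statistic: $L(\mathbf{X})=\sup\max_i\|\mathbf{S}_i-\mathbb{E}\mathbf{S}_i\|$, where $\sup$ is the (essential) supremum over the randomness. All expectations involved are tacitly assumed to be defined and finite. *)

theory Defs
  imports "HOL-Analysis.Analysis" "HOL-Probability.Probability"
begin

text \<open>
  Matrices of dimension \<open>d = CARD('d)\<close> are elements of \<open>complex^'d^'d\<close>; real matrices are those
  whose entries all have zero imaginary part. The expectation of a random matrix is its Bochner
  integral, which is computed entry by entry.
\<close>

definition self_adjoint :: "complex^'d^'d \<Rightarrow> bool" where
  "self_adjoint A \<longleftrightarrow> (\<chi> i j. cnj (A $ j $ i)) = A"

definition spectral_norm :: "complex^'d^'d \<Rightarrow> real" where
  "spectral_norm A = onorm (\<lambda>v. A *v v)"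

definition normalized_trace :: "complex^'d^'d \<Rightarrow> complex" where
  "normalized_trace A = trace A / of_nat CARD('d)"

definition kronecker :: "complex^'d^'d \<Rightarrow> complex^'d^'d \<Rightarrow> complex^('d \<times> 'd)^('d \<times> 'd)" where
  "kronecker A B = (\<chi> p q. A $ fst p $ fst q * B $ snd p $ snd q)"

definition centered :: "'a measure \<Rightarrow> ('a \<Rightarrow> complex^'d^'d) \<Rightarrow> 'a \<Rightarrow> complex^'d^'d" where
  "centered M Y \<omega> = Y \<omega> - (\<integral>\<omega>'. Y \<omega>' \<partial>M)"

definition variance_tensor ::
    "'a measure \<Rightarrow> ('a \<Rightarrow> complex^'d^'d) \<Rightarrow> complex^('d \<times> 'd)^('d \<times> 'd)" where
  "variance_tensor M Y = (\<integral>\<omega>. kronecker (centered M Y \<omega>) (centered M Y \<omega>) \<partial>M)"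

definition matrix_variance :: "'a measure \<Rightarrow> ('a \<Rightarrow> complex^'d^'d) \<Rightarrow> real" where
  "matrix_variance M Y = spectral_norm (\<integral>\<omega>. centered M Y \<omega> ** centered M Y \<omega> \<partial>M)"

text \<open>The uniform bound takes the value \<open>\<infinity>\<close> when some summand is not essentially bounded.\<close>

definition uniform_bound ::
    "'a measure \<Rightarrow> nat \<Rightarrow> (nat \<Rightarrow> 'a \<Rightarrow> complex^'d^'d) \<Rightarrow> ennreal" where
  "uniform_bound M n S =
     esssup M (\<lambda>\<omega>. SUP i\<in>{1..n}. ennreal (spectral_norm (centered M (S i) \<omega>)))"

definition cauchy_transform ::
    "'a measure \<Rightarrow> ('a \<Rightarrow> complex^'d^'d) \<Rightarrow> complex \<Rightarrow> complex" where
  "cauchy_transform M Y \<zeta> = (\<integral>\<omega>. normalized_trace (matrix_inv (mat \<zeta> - Y \<omega>)) \<partial>M)"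

text \<open>Degenerate (almost surely constant) variables count as Gaussian.\<close>

definition gaussian_rv :: "'a measure \<Rightarrow> ('a \<Rightarrow> real) \<Rightarrow> bool" where
  "gaussian_rv M Y \<longleftrightarrow> Y \<in> borel_measurable M \<and>
     (\<exists>\<mu>. (AE \<omega> in M. Y \<omega> = \<mu>) \<or>
          (\<exists>\<sigma>>0. distributed M lborel Y (\<lambda>x. ennreal (normal_density \<mu> \<sigma> x))))"

definition jointly_gaussian :: "'a measure \<Rightarrow> 'i set \<Rightarrow> ('i \<Rightarrow> 'a \<Rightarrow> real) \<Rightarrow> bool" where
  "jointly_gaussian M I Y \<longleftrightarrow> finite I \<and> (\<forall>c. gaussian_rv M (\<lambda>\<omega>. \<Sum>i\<in>I. c i * Y i \<omega>))"

definition gaussian_matrix :: "'a measure \<Rightarrow> ('a \<Rightarrow> complex^'d^'d) \<Rightarrow> bool" where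
  "gaussian_matrix M Z \<longleftrightarrow>
     jointly_gaussian M (UNIV :: ('d \<times> 'd + 'd \<times> 'd) set)
       (case_sum (\<lambda>(i, j) \<omega>. Re (Z \<omega> $ i $ j)) (\<lambda>(i, j) \<omega>. Im (Z \<omega> $ i $ j)))"

end

(*
  Write A_i = S_i - E S_i, let G be the centered Gaussian matrix, and interpolate by
  Y(t) = E X + sin t (sum_i A_i) + cos t G.  Put F(t) = E trace R(Y(t)) with the resolvent R.  The
  derivative F' is E trace (R^2 (cos t sum_i A_i - sin t G)).  Gaussian integration by parts turns the
  second part into 2 sin t cos t q, where q = E trace (R^2 G' R G') for an independent copy G' of G;
  since the variance tensors agree, G' may be replaced by independent copies of the A_i.  For the first
  part, expand R around the resolvent without the summand A_i: the first order term vanishes, the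
  second order term is 2 sin t cos t q up to replacing that resolvent by R again.  Both third order
  errors are bounded through |trace (P A Q A)| <= |P| |Q| |A|_F^2, which gives
  |F'(t)| <= 9 sin^2 t cos t L |Im zeta|^(-4) sum_i E |A_i|_F^2.  Integrating over [0, pi/2] yields the
  constant 3.
*)
theory Submission
  imports Defs
begin

section \<open>Matrix norms\<close>

text \<open>Sine and cosine are chosen because sin^2 + cos^2 = 1 keeps the covariance of Y(t)
  constant in t. Both halves of F' then carry q with the same coefficient 2 sin t cos t, so q
  cancels and only third order terms survive. The obstacle is the dimension d. In each remainder
  just one factor A_i is measured in spectral norm, which produces L; the other two are measured in
  Frobenius norm. Since sum_i E |A_i|_F^2 = trace E (X - E X)^2 \<le> d \<sigma>^2(X), a single
  factor d appears, and the normalized trace absorbs it. Cruder bounds with powers of d occur too,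
  but only to secure integrability. X and Z may live on unrelated probability spaces. The
  interpolation takes place on the product space, where they are independent. Integration by parts
  comes from rotation invariance of a pair of independent Gaussian copies, read off from
  characteristic functions; no density of the matrix is involved, so singular covariances are
  harmless. The 9 is 3 + 2 * 3: three remainders of the expansion, and three from restoring the full
  resolvent in a term with coefficient 2.\<close>

lemma matrix_mult_diff_left: "(A - B) ** C = A ** C - B ** (C :: complex^'d^'d)"
  by (vector matrix_matrix_mult_def sum_subtractf left_diff_distrib)

lemma matrix_mult_diff_right: "C ** (A - B) = C ** A - C ** (B :: complex^'d^'d)"
  by (vector matrix_matrix_mult_def sum_subtractf right_diff_distrib)

lemma matrix_mult_add_left: "(A + B) ** C = A ** C + B ** (C :: complex^'d^'d)"
  by (vector matrix_matrix_mult_def sum.distrib distrib_right)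

lemma matrix_mult_scaleR_left: "(r *\<^sub>R A) ** C = r *\<^sub>R (A ** (C :: complex^'d^'d))"
  by (simp add: scalar_matrix_assoc)

lemma matrix_mult_scaleR_right: "C ** (r *\<^sub>R A) = r *\<^sub>R (C ** (A :: complex^'d^'d))"
  by (simp add: scalar_matrix_assoc matrix_scalar_ac)

lemma trace_scaleR: "trace (r *\<^sub>R A) = of_real r * trace (A :: complex^'d^'d)"
  by (simp add: trace_def sum_distrib_left scaleR_conv_of_real[where 'a=complex])

lemma trace_mult_sum: "trace (A ** B) = (\<Sum>i\<in>UNIV. \<Sum>j\<in>UNIV. A $ i $ j * (B :: complex^'d^'d) $ j $ i)"
  by (simp add: trace_def matrix_matrix_mult_def)

lemma bounded_linear_mult_vec: "bounded_linear (\<lambda>v. (A :: complex^'d^'d) *v v)"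
  using matrix_vector_mul_linear linear_conv_bounded_linear by blast

lemma norm_mult_vec_le_spectral: "norm (A *v v) \<le> spectral_norm A * norm v"
  unfolding spectral_norm_def by (rule onorm[OF bounded_linear_mult_vec])

lemma spectral_norm_nonneg: "0 \<le> spectral_norm A"
  unfolding spectral_norm_def by (rule onorm_pos_le[OF bounded_linear_mult_vec])

lemma spectral_norm_leI: "(\<And>v. norm (A *v v) \<le> c * norm v) \<Longrightarrow> spectral_norm A \<le> c"
  unfolding spectral_norm_def by (rule onorm_le)

lemma spectral_norm_mult: "spectral_norm (A ** B) \<le> spectral_norm A * spectral_norm B"
proof (rule spectral_norm_leI)
  fix v
  have "norm ((A ** B) *v v) \<le> spectral_norm A * norm (B *v v)"
    by (simp add: matrix_vector_mul_assoc[symmetric] norm_mult_vec_le_spectral)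
  also have "\<dots> \<le> spectral_norm A * (spectral_norm B * norm v)"
    by (intro mult_left_mono norm_mult_vec_le_spectral spectral_norm_nonneg)
  finally show "norm ((A ** B) *v v) \<le> spectral_norm A * spectral_norm B * norm v"
    by (simp add: mult.assoc)
qed

section \<open>The Frobenius norm, which is the built-in norm of the matrix type, and the
  trace\<close>

lemma norm_matrix_sq: "(norm (A :: complex^'d^'d))\<^sup>2 = (\<Sum>i\<in>UNIV. \<Sum>j\<in>UNIV. (cmod (A $ i $ j))\<^sup>2)"
  by (simp add: norm_vec_def L2_set_def sum_nonneg)

text \<open>Column j of the product is \<open>A\<close> applied to column j of \<open>B\<close>, and
  squared column norms add up to the squared Frobenius norm. This mixed inequality extracts
  resolvents in spectral norm at no cost in the dimension.\<close>

lemma norm_mult_le_spectral: "norm (A ** B) \<le> spectral_norm A * norm (B :: complex^'d^'d)"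
proof -
  have col: "(A ** B) $ i $ j = (A *v column j B) $ i" for i j
    by (simp add: matrix_matrix_mult_def matrix_vector_mult_def column_def)
  have sq: "(norm (v :: complex^'d))\<^sup>2 = (\<Sum>i\<in>UNIV. (cmod (v $ i))\<^sup>2)" for v
    by (simp add: norm_vec_def L2_set_def sum_nonneg)
  have "(norm (A ** B))\<^sup>2 = (\<Sum>j\<in>UNIV. (norm (A *v column j B))\<^sup>2)"
    unfolding norm_matrix_sq col sq by (rule sum.swap)
  also have "\<dots> \<le> (\<Sum>j\<in>UNIV. (spectral_norm A * norm (column j B))\<^sup>2)"
    by (intro sum_mono power_mono norm_mult_vec_le_spectral) simp
  also have "\<dots> = (spectral_norm A)\<^sup>2 * (\<Sum>j\<in>UNIV. \<Sum>i\<in>UNIV. (cmod (B $ i $ j))\<^sup>2)"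
    unfolding power_mult_distrib sum_distrib_left[symmetric] sq by (simp add: column_def)
  also have "\<dots> = (spectral_norm A * norm B)\<^sup>2"
    unfolding power_mult_distrib norm_matrix_sq by (subst sum.swap) simp
  finally show ?thesis
    by (rule power2_le_imp_le) (simp add: spectral_norm_nonneg)
qed

lemma norm_transpose: "norm (transpose A) = norm (A :: complex^'d^'d)"
proof -
  have "(norm (transpose A))\<^sup>2 = (norm A)\<^sup>2"
    unfolding norm_matrix_sq by (subst sum.swap) (simp add: transpose_def)
  thus ?thesis by simp
qed

text \<open>Cauchy-Schwarz over all entries: the trace pairs \<open>A\<close> with the transpose of
  \<open>B\<close>, and transposing preserves the Frobenius norm.\<close>

lemma norm_trace_mult: "cmod (trace (A ** B)) \<le> norm A * norm (B :: complex^'d^'d)"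
proof -
  have "cmod (trace (A ** B)) \<le> (\<Sum>(i,j)\<in>UNIV. cmod (A $ i $ j) * cmod (B $ j $ i))"
    unfolding trace_mult_sum sum.cartesian_product UNIV_Times_UNIV[symmetric]
    by (rule order_trans[OF norm_sum]) (simp add: norm_mult case_prod_beta)
  also have "\<dots> \<le> L2_set (\<lambda>(i,j). cmod (A $ i $ j)) UNIV * L2_set (\<lambda>(i,j). cmod (B $ j $ i)) UNIV"
    using L2_set_mult_ineq[of "\<lambda>(i,j). cmod (A $ i $ j)" "\<lambda>(i,j). cmod (B $ j $ i)" UNIV]
    by (simp add: case_prod_beta)
  also have "L2_set (\<lambda>(i,j). cmod (A $ i $ j)) UNIV = norm A"
    unfolding L2_set_def
    by (rule real_sqrt_unique) (simp_all add: norm_matrix_sq sum.cartesian_product case_prod_beta)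
  also have "L2_set (\<lambda>(i,j). cmod (B $ j $ i)) UNIV = norm (transpose B)"
    unfolding L2_set_def
    by (rule real_sqrt_unique) (simp_all add: norm_matrix_sq sum.cartesian_product case_prod_beta transpose_def)
  finally show ?thesis by (simp add: norm_transpose)
qed

lemma norm_vec_mult_le: "norm (A *v v) \<le> norm (A :: complex^'d^'d) * norm v"
proof -
  have "(norm (A *v v))\<^sup>2 = (\<Sum>i\<in>UNIV. (cmod (\<Sum>j\<in>UNIV. A $ i $ j * v $ j))\<^sup>2)"
    by (simp add: norm_vec_def L2_set_def sum_nonneg matrix_vector_mult_def)
  also have "\<dots> \<le> (\<Sum>i\<in>UNIV. (norm (A $ i) * norm v)\<^sup>2)"
  proof (intro sum_mono power_mono)
    fix i
    have "cmod (\<Sum>j\<in>UNIV. A $ i $ j * v $ j) \<le> (\<Sum>j\<in>UNIV. \<bar>cmod (A $ i $ j)\<bar> * \<bar>cmod (v $ j)\<bar>)"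
      by (rule order_trans[OF norm_sum]) (simp add: norm_mult)
    also have "\<dots> \<le> norm (A $ i) * norm v"
      unfolding norm_vec_def by (rule L2_set_mult_ineq)
    finally show "cmod (\<Sum>j\<in>UNIV. A $ i $ j * v $ j) \<le> norm (A $ i) * norm v" .
  qed simp
  also have "\<dots> = (norm A * norm v)\<^sup>2"
    by (simp add: power_mult_distrib sum_distrib_right[symmetric] norm_vec_def[of A] L2_set_def sum_nonneg)
  finally show ?thesis by (rule power2_le_imp_le) simp
qed

lemma spectral_norm_le_norm: "spectral_norm A \<le> norm A"
  by (rule spectral_norm_leI) (rule norm_vec_mult_le)

lemma norm_matrix_mult: "norm (A ** B) \<le> norm (A :: complex^'d^'d) * norm (B :: complex^'d^'d)"
  using norm_mult_le_spectral[of A B] mult_right_mono[OF spectral_norm_le_norm[of A], of "norm B"] by simp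

text \<open>Submultiplicativity of the Frobenius norm gives the constant 1. The product rule for
  derivatives and the continuity and sum rules for \<open>**\<close> are drawn from this
  interpretation.\<close>

interpretation matrix_mult: bounded_bilinear "(**) :: complex^'d^'d \<Rightarrow> complex^'d^'d \<Rightarrow> complex^'d^'d"
  by unfold_locales
     (auto simp: matrix_mult_add_left matrix_add_ldistrib matrix_mult_scaleR_left matrix_mult_scaleR_right
        intro!: exI[of _ 1] norm_matrix_mult)

lemma norm_trace: "cmod (trace A) \<le> norm (mat 1 :: complex^'d^'d) * norm (A :: complex^'d^'d)"
  using norm_trace_mult[of "mat 1" A] by simp

lemma bounded_linear_trace: "bounded_linear (trace :: complex^'d^'d \<Rightarrow> complex)"
proof
  show "\<exists>K. \<forall>x::complex^'d^'d. norm (trace x) \<le> norm x * K"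
    by (intro exI[of _ "norm (mat 1 :: complex^'d^'d)"]) (metis norm_trace mult.commute)
qed (auto simp: trace_add trace_scaleR scaleR_conv_of_real[where 'a=complex])

text \<open>A diagonal entry is a coordinate of the image of a unit vector. The factor d introduced
  here is the one that the normalized trace cancels at the end.\<close>

lemma norm_trace_le_spectral: "cmod (trace A) \<le> real CARD('d) * spectral_norm (A :: complex^'d^'d)"
proof -
  have "cmod (A $ i $ i) \<le> spectral_norm A" for i
  proof -
    have "A $ i $ i = (A *v axis i 1) $ i"
      by (simp add: matrix_vector_mul_component inner_axis matrix_vector_mult_def axis_def if_distrib cong: if_cong)
    also have "cmod \<dots> \<le> norm (A *v axis i 1)" by (rule Finite_Cartesian_Product.norm_nth_le)
    also have "\<dots> \<le> spectral_norm A" using norm_mult_vec_le_spectral[of A "axis i 1"] by simp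
    finally show ?thesis .
  qed
  hence "(\<Sum>i\<in>UNIV. cmod (A $ i $ i)) \<le> (\<Sum>i\<in>(UNIV :: 'd set). spectral_norm A)"
    by (intro sum_mono)
  thus ?thesis unfolding trace_def by (intro order_trans[OF norm_sum]) simp
qed

lemma spectral_norm_mult_le:
  "spectral_norm P \<le> p \<Longrightarrow> spectral_norm Q \<le> q \<Longrightarrow> spectral_norm (P ** Q) \<le> p * q"
  using order_trans[OF spectral_norm_mult mult_mono, of P p Q q]
  by (simp add: spectral_norm_nonneg order_trans[OF spectral_norm_nonneg, of P])

text \<open>Group the product as (P A)(Q A), apply Cauchy-Schwarz, then pull out \<open>P\<close>
  and \<open>Q\<close> in spectral norm. In the applications a third summand is hidden inside
  \<open>P\<close> or \<open>Q\<close> and so is charged to L.\<close>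

lemma trace_mult4_bound:
  assumes "spectral_norm P \<le> p" "spectral_norm Q \<le> q"
  shows "cmod (trace (P ** A ** Q ** A)) \<le> p * q * (norm (A :: complex^'d^'d))\<^sup>2"
proof -
  have "0 \<le> p" "0 \<le> q" using assms spectral_norm_nonneg order_trans by blast+
  have "cmod (trace (P ** A ** Q ** A)) \<le> norm (P ** A) * norm (Q ** A)"
    using norm_trace_mult[of "P ** A" "Q ** A"] by (simp add: matrix_mul_assoc)
  also have "\<dots> \<le> (p * norm A) * (q * norm A)"
    using assms \<open>0 \<le> p\<close>
    by (intro mult_mono order_trans[OF norm_mult_le_spectral] mult_right_mono) auto
  finally show ?thesis by (simp add: power2_eq_square mult_ac)
qed

section \<open>Self-adjoint matrices and resolvents\<close>

lemma self_adjoint_nth: "self_adjoint A \<longleftrightarrow> (\<forall>i j. cnj (A $ j $ i) = A $ i $ j)"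
  by (auto simp: self_adjoint_def vec_eq_iff)

lemma self_adjoint_add: "self_adjoint A \<Longrightarrow> self_adjoint B \<Longrightarrow> self_adjoint (A + B)"
  and self_adjoint_diff: "self_adjoint A \<Longrightarrow> self_adjoint B \<Longrightarrow> self_adjoint (A - B)"
  and self_adjoint_scaleR: "self_adjoint A \<Longrightarrow> self_adjoint (r *\<^sub>R A)"
  and self_adjoint_zero: "self_adjoint 0"
  by (auto simp: self_adjoint_nth)

lemma self_adjoint_sum: "(\<And>i. i \<in> I \<Longrightarrow> self_adjoint (f i)) \<Longrightarrow> self_adjoint (sum f I)"
  by (induction I rule: infinite_finite_induct) (auto simp: self_adjoint_add self_adjoint_zero)

lemma trace_square_self_adjoint:
  assumes "self_adjoint A"
  shows "trace (A ** A) = of_real ((norm A)\<^sup>2)"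
proof -
  have "A $ i $ j * A $ j $ i = of_real ((cmod (A $ i $ j))\<^sup>2)" for i j
    using assms complex_norm_square[of "A $ i $ j"] unfolding self_adjoint_nth by metis
  thus ?thesis by (simp add: trace_mult_sum norm_matrix_sq)
qed

definition hermitian_part :: "complex^'d^'d \<Rightarrow> complex^'d^'d" where
  "hermitian_part A = (1/2) *\<^sub>R (A + (\<chi> i j. cnj (A $ j $ i)))"

lemma self_adjoint_hermitian_part: "self_adjoint (hermitian_part A)"
  by (simp add: self_adjoint_nth hermitian_part_def add.commute)

lemma hermitian_part_self_adjoint: "self_adjoint A \<Longrightarrow> hermitian_part A = A"
  by (simp add: self_adjoint_def hermitian_part_def scaleR_2[symmetric])

lemma continuous_on_hermitian_part: "continuous_on UNIV hermitian_part"
  unfolding hermitian_part_def by (intro continuous_intros)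

locale resolvent =
  fixes \<zeta> :: complex
  assumes nonreal: "\<zeta> \<notin> \<real>"
begin

definition \<beta> :: real where "\<beta> = 1 / \<bar>Im \<zeta>\<bar>"

lemma Im_pos: "\<bar>Im \<zeta>\<bar> > 0" using nonreal complex_is_Real_iff by auto
lemma \<beta>_pos: "\<beta> > 0" using Im_pos by (simp add: \<beta>_def)

text \<open>The real inner product is the real part of the Hermitian form. Since v^* A v is real,
  pairing (\<zeta> - A) v with i v kills the contribution of \<open>A\<close> and leaves Im \<zeta>
  |v|^2; Cauchy-Schwarz does the rest.\<close>

lemma norm_shift_ge:
  assumes "self_adjoint A"
  shows "\<bar>Im \<zeta>\<bar> * norm v \<le> norm ((mat \<zeta> - A) *v v)"
proof -
  define S where "S = (\<Sum>i\<in>UNIV. \<Sum>j\<in>UNIV. cnj (v $ i) * A $ i $ j * v $ j)"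
  have "cnj S = (\<Sum>i\<in>UNIV. \<Sum>j\<in>UNIV. cnj (v $ j) * A $ j $ i * v $ i)"
    using assms by (simp add: S_def self_adjoint_nth mult_ac)
  also have "\<dots> = S" unfolding S_def by (rule sum.swap)
  finally have ImS: "Im S = 0" by (metis Reals_cnj_iff complex_is_Real_iff)
  have inn: "x \<bullet> y = Re (cnj x * y)" for x y :: complex by (simp add: inner_complex_def)
  have z: "mat \<zeta> *v v = \<zeta> *s v"
    by (simp add: vec_eq_iff matrix_vector_mult_def mat_def if_distrib if_distribR cong: if_cong)
  have "(\<i> *s v) \<bullet> (A *v v) = Re (\<Sum>i\<in>UNIV. cnj (\<i> * v $ i) * (\<Sum>j\<in>UNIV. A $ i $ j * v $ j))"
    by (simp add: inner_vec_def inn matrix_vector_mult_def Re_sum del: complex_cnj_mult)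
  also have "\<dots> = Re (- \<i> * S)"
    by (simp add: S_def sum_distrib_left sum_negf mult_ac)
  also have "\<dots> = 0" using ImS by simp
  finally have 1: "(\<i> *s v) \<bullet> (A *v v) = 0" .
  have "(\<i> *s v) \<bullet> (\<zeta> *s v) = (\<Sum>i\<in>UNIV. Im \<zeta> * (cmod (v $ i))\<^sup>2)"
    unfolding inner_vec_def inn cmod_power2
    by (intro sum.cong refl) (simp add: algebra_simps power2_eq_square)
  also have "\<dots> = Im \<zeta> * (norm v)\<^sup>2"
    by (simp add: sum_distrib_left norm_vec_def L2_set_def sum_nonneg)
  finally have "\<bar>Im \<zeta>\<bar> * norm v * norm v = \<bar>(\<i> *s v) \<bullet> ((mat \<zeta> - A) *v v)\<bar>"
    using 1 by (simp add: matrix_vector_mult_diff_rdistrib inner_diff_right z abs_mult power2_eq_square)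
  also have "\<dots> \<le> norm (\<i> *s v) * norm ((mat \<zeta> - A) *v v)" by (rule Cauchy_Schwarz_ineq2)
  also have "norm (\<i> *s v) = norm v" by (simp add: norm_vec_def norm_mult)
  finally show ?thesis
    by (cases "v = 0") (auto simp: mult_ac)
qed

text \<open>Passing to the Hermitian part makes the resolvent a globally continuous function of the matrix,
  so that no measurability question arises.\<close>

definition R :: "complex^'d^'d \<Rightarrow> complex^'d^'d" where
  "R A = matrix_inv (mat \<zeta> - hermitian_part A)"

lemma R_self_adjoint: "self_adjoint A \<Longrightarrow> R A = matrix_inv (mat \<zeta> - A)"
  by (simp add: R_def hermitian_part_self_adjoint)

lemma invertible_shift:
  assumes "self_adjoint A"
  shows "invertible (mat \<zeta> - A)"
  unfolding invertible_left_inverse matrix_left_invertible_ker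
  using norm_shift_ge[OF assms] Im_pos by (metis mult_le_0_iff norm_le_zero_iff norm_zero not_less)

lemma R_mult: "R A ** (mat \<zeta> - hermitian_part A) = mat 1" "(mat \<zeta> - hermitian_part A) ** R A = mat 1"
proof -
  have "\<exists>B. (mat \<zeta> - hermitian_part A) ** B = mat 1 \<and> B ** (mat \<zeta> - hermitian_part A) = mat 1"
    using invertible_shift[OF self_adjoint_hermitian_part[of A]] by (simp add: invertible_def)
  from someI_ex[OF this]
  show "R A ** (mat \<zeta> - hermitian_part A) = mat 1" "(mat \<zeta> - hermitian_part A) ** R A = mat 1"
    unfolding R_def matrix_inv_def by blast+
qed

lemma spectral_norm_R: "spectral_norm (R A) \<le> \<beta>"
proof (rule spectral_norm_leI)
  fix v
  have "\<bar>Im \<zeta>\<bar> * norm (R A *v v) \<le> norm v"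
    using norm_shift_ge[OF self_adjoint_hermitian_part, of "R A *v v" A]
    by (simp add: matrix_vector_mul_assoc R_mult)
  thus "norm (R A *v v) \<le> \<beta> * norm v" using Im_pos by (simp add: \<beta>_def field_simps)
qed

text \<open>The second resolvent identity, obtained from B' - A' = (\<zeta> - A') - (\<zeta> - B')
  up to sign, where primes denote Hermitian parts. Continuity, the derivative and both expansions of
  the resolvent rest on it.\<close>

lemma R_diff_hermitian_part: "R A - R B = R A ** (hermitian_part A - hermitian_part B) ** R B"
proof -
  have "R A ** (hermitian_part A - hermitian_part B) ** R B
     = R A ** (mat \<zeta> - hermitian_part B) ** R B - R A ** (mat \<zeta> - hermitian_part A) ** R B"
    by (simp add: matrix_mult_diff_left matrix_mult_diff_right)
  also have "\<dots> = R A - R B"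
    by (simp add: R_mult matrix_mul_assoc[symmetric])
  finally show ?thesis ..
qed

lemma R_diff:
  assumes "self_adjoint A" "self_adjoint B"
  shows "R A - R B = R A ** (A - B) ** R B"
  using R_diff_hermitian_part[of A B] by (simp add: hermitian_part_self_adjoint assms)

text \<open>A Frobenius bound for resolvents. The \<open>itself\<close> argument carries the
  dimension, since the locale fixes no matrix type. It depends on d and is used for continuity,
  derivatives and integrability, never in the final estimate.\<close>

definition \<gamma> :: "'d::finite itself \<Rightarrow> real" where "\<gamma> _ = \<beta> * norm (mat 1 :: complex^'d^'d)"

lemma norm_R: "norm (R A :: complex^'d^'d) \<le> \<gamma> TYPE('d)"
  using norm_mult_le_spectral[of "R A" "mat 1"] spectral_norm_R[of A]
  unfolding \<gamma>_def by (simp add: order_trans mult_right_mono)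

lemma \<gamma>_nonneg: "0 \<le> \<gamma> TYPE('d::finite)" using \<beta>_pos by (simp add: \<gamma>_def)

lemma norm_R_diff:
  "norm (R A - R B) \<le> (\<gamma> TYPE('d))\<^sup>2 * norm (hermitian_part A - hermitian_part (B :: complex^'d^'d))"
proof -
  have "norm (R A - R B) \<le> norm (R A) * norm (hermitian_part A - hermitian_part B) * norm (R B)"
    unfolding R_diff_hermitian_part
    by (rule order_trans[OF norm_matrix_mult mult_right_mono[OF norm_matrix_mult]]) simp
  also have "\<dots> \<le> \<gamma> TYPE('d) * norm (hermitian_part A - hermitian_part B) * \<gamma> TYPE('d)"
    by (intro mult_mono norm_R mult_nonneg_nonneg \<gamma>_nonneg) auto
  finally show ?thesis by (simp add: power2_eq_square mult_ac)
qed

lemma continuous_on_R: "continuous_on UNIV (R :: complex^'d^'d \<Rightarrow> _)"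
  unfolding continuous_on_def
proof
  fix B :: "complex^'d^'d"
  have "((\<lambda>A. (\<gamma> TYPE('d))\<^sup>2 * norm (hermitian_part A - hermitian_part B)) \<longlongrightarrow>
      (\<gamma> TYPE('d))\<^sup>2 * norm (hermitian_part B - hermitian_part B)) (at B)"
    using continuous_on_hermitian_part unfolding continuous_on_def by (intro tendsto_intros) auto
  hence "((\<lambda>A. (\<gamma> TYPE('d))\<^sup>2 * norm (hermitian_part A - hermitian_part B)) \<longlongrightarrow> 0) (at B)"
    by simp
  hence "((\<lambda>A. R A - R B) \<longlongrightarrow> 0) (at B)"
    by (rule Lim_null_comparison[OF always_eventually[OF allI[OF norm_R_diff[where B = B]]]])
  thus "(R \<longlongrightarrow> R B) (at B within UNIV)" by (simp add: LIM_zero_iff)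
qed

lemma R_measurable [measurable]: "(R :: complex^'d^'d \<Rightarrow> _) \<in> borel_measurable borel"
  by (rule borel_measurable_continuous_onI[OF continuous_on_R])

text \<open>With the resolvent identity the remainder splits in two: one part contains the remainder
  of \<open>Y\<close>, the other contains R(Y u) - R(Y t) times u - t and is controlled by
  continuity of \<open>R\<close>. Self-adjointness along the whole curve removes the Hermitian
  parts.\<close>

lemma R_has_vector_derivative:
  fixes Y :: "real \<Rightarrow> complex^'d^'d"
  assumes Y: "(Y has_vector_derivative Y') (at t)" and sa: "\<And>u. self_adjoint (Y u)"
  shows "((\<lambda>u. R (Y u)) has_vector_derivative R (Y t) ** Y' ** R (Y t)) (at t)"
proof -
  let ?g = "\<gamma> TYPE('d)"
  have lim: "((\<lambda>u. norm (Y u - Y t - (u - t) *\<^sub>R Y') / norm (u - t)) \<longlongrightarrow> 0) (at t)"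
    using Y unfolding has_vector_derivative_def has_derivative_iff_norm by simp
  have "continuous (at t) Y" using Y by (rule has_vector_derivative_continuous)
  hence "((\<lambda>u. R (Y u)) \<longlongrightarrow> R (Y t)) (at t)"
    using continuous_on_R by (metis continuous_at_imp_continuous_on continuous_on_eq_continuous_at
      continuous_at open_UNIV UNIV_I isCont_tendsto_compose)
  hence limR: "((\<lambda>u. norm (R (Y u) - R (Y t))) \<longlongrightarrow> 0) (at t)"
    by (simp add: tendsto_norm_zero LIM_zero)
  have "((\<lambda>u. norm (R (Y u) - R (Y t) - (u - t) *\<^sub>R (R (Y t) ** Y' ** R (Y t))) / norm (u - t)) \<longlongrightarrow> 0) (at t)"
  proof (rule tendsto_sandwich[OF _ _ tendsto_const])
    show "((\<lambda>u. ?g * (norm (Y u - Y t - (u - t) *\<^sub>R Y') / norm (u - t)) * ?g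
        + norm (R (Y u) - R (Y t)) * norm Y' * ?g) \<longlongrightarrow> 0) (at t)"
      by (rule tendsto_eq_intros lim limR refl | simp)+
    have "norm (R (Y u) - R (Y t) - (u - t) *\<^sub>R (R (Y t) ** Y' ** R (Y t))) / norm (u - t)
        \<le> ?g * (norm (Y u - Y t - (u - t) *\<^sub>R Y') / norm (u - t)) * ?g
          + norm (R (Y u) - R (Y t)) * norm Y' * ?g" if "u \<noteq> t" for u
    proof -
      let ?E = "Y u - Y t - (u - t) *\<^sub>R Y'"
      have "R (Y u) ** ?E ** R (Y t) = (R (Y u) - R (Y t)) - (u - t) *\<^sub>R (R (Y u) ** Y' ** R (Y t))"
        unfolding R_diff[OF sa sa, of u t]
        by (simp add: matrix_mult_diff_left matrix_mult_diff_right matrix_mult_scaleR_left matrix_mult_scaleR_right)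
      hence "R (Y u) - R (Y t) - (u - t) *\<^sub>R (R (Y t) ** Y' ** R (Y t))
        = R (Y u) ** ?E ** R (Y t) + (u - t) *\<^sub>R ((R (Y u) - R (Y t)) ** Y' ** R (Y t))"
        by (simp add: matrix_mult_diff_left scaleR_diff_right)
      also have "norm \<dots> \<le> norm (R (Y u)) * norm ?E * norm (R (Y t))
          + \<bar>u - t\<bar> * (norm (R (Y u) - R (Y t)) * norm Y' * norm (R (Y t)))"
        by (intro norm_triangle_le add_mono)
           (auto intro!: mult_left_mono intro: order_trans[OF norm_matrix_mult mult_right_mono[OF norm_matrix_mult]])
      also have "\<dots> \<le> ?g * norm ?E * ?g + \<bar>u - t\<bar> * (norm (R (Y u) - R (Y t)) * norm Y' * ?g)"
        by (intro add_mono mult_mono norm_R mult_nonneg_nonneg \<gamma>_nonneg) auto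
      finally show ?thesis using that by (simp add: field_simps)
    qed
    thus "\<forall>\<^sub>F u in at t. norm (R (Y u) - R (Y t) - (u - t) *\<^sub>R (R (Y t) ** Y' ** R (Y t))) / norm (u - t)
        \<le> ?g * (norm (Y u - Y t - (u - t) *\<^sub>R Y') / norm (u - t)) * ?g
          + norm (R (Y u) - R (Y t)) * norm Y' * ?g"
      by (auto simp: eventually_at_filter)
  qed auto
  thus ?thesis
    unfolding has_vector_derivative_def has_derivative_iff_norm by (simp add: bounded_linear_scaleR_left)
qed

text \<open>Every third order remainder is a trace of the form P A Q A with four resolvents in total
  and the third \<open>A\<close> inside Q. There are three of them, whence 3 L \<beta>^4.\<close>

lemma trace_resolvent_expansion:
  fixes A W :: "complex^'d^'d" and s :: real
  assumes "self_adjoint A" "self_adjoint W" "spectral_norm A \<le> L"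
  defines "Y \<equiv> W + s *\<^sub>R A"
  shows "cmod (trace (R Y ** R Y ** A) - trace (R W ** R W ** A)
      - 2 * s * trace (R W ** R W ** A ** R W ** A)) \<le> 3 * s\<^sup>2 * L * \<beta> ^ 4 * (norm A)\<^sup>2"
proof -
  define r p where "r = R Y" and "p = R W"
  have sr: "spectral_norm r \<le> \<beta>" and sp: "spectral_norm p \<le> \<beta>"
    by (simp_all add: r_def p_def spectral_norm_R)
  have saY: "self_adjoint Y" unfolding Y_def using assms by (intro self_adjoint_add self_adjoint_scaleR)
  have e1: "r = p + s *\<^sub>R (r ** A ** p)"
    using R_diff[OF saY assms(2)]
    by (simp add: r_def p_def Y_def matrix_mult_scaleR_left matrix_mult_scaleR_right algebra_simps)
  have e2: "r = p + s *\<^sub>R (p ** A ** r)"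
    using R_diff[OF assms(2) saY]
    by (simp add: r_def p_def Y_def matrix_mult.minus_left matrix_mult.minus_right matrix_mult_scaleR_left matrix_mult_scaleR_right algebra_simps)
  note dist = matrix_mult_add_left matrix_add_ldistrib matrix_mult_scaleR_left matrix_mult_scaleR_right matrix_mul_assoc
  \<comment> \<open>The left factor is expanded with \<open>p\<close> outermost on the left, the
    right one with \<open>p\<close> outermost on the right. One further expansion of each cross term
    then brings it to second order.\<close>
  have "r ** r = (p + s *\<^sub>R (p ** A ** r)) ** (p + s *\<^sub>R (r ** A ** p))"
    using e1 e2 by simp
  also have "\<dots> = p ** p + s *\<^sub>R (p ** r ** A ** p) + s *\<^sub>R (p ** A ** r ** p) + s\<^sup>2 *\<^sub>R (p ** A ** r ** r ** A ** p)"
    by (simp add: dist power2_eq_square algebra_simps)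
  also have "p ** r = p ** p + s *\<^sub>R (p ** p ** A ** r)"
    by (subst e2) (simp add: dist)
  also have "p ** A ** r ** p = p ** A ** p ** p + s *\<^sub>R (p ** A ** r ** A ** p ** p)"
    by (subst e1) (simp add: dist)
  finally have rr: "r ** r = p ** p + s *\<^sub>R (p ** p ** A ** p + p ** A ** p ** p)
      + s\<^sup>2 *\<^sub>R (p ** p ** A ** r ** A ** p + p ** A ** r ** A ** p ** p + p ** A ** r ** r ** A ** p)"
    by (simp add: dist power2_eq_square algebra_simps)
  \<comment> \<open>Cyclicity merges the two terms of order s; this is the 2 in the
    statement.\<close>
  have cyc: "trace (p ** A ** p ** p ** A) = trace (p ** p ** A ** p ** A)"
    using trace_mul_sym[of "p ** A" "p ** p ** A"] by (simp add: matrix_mul_assoc)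
  let ?T1 = "trace ((p ** p) ** A ** (r ** A ** p) ** A)"
  let ?T2 = "trace (p ** A ** (r ** A ** p ** p) ** A)"
  let ?T3 = "trace (p ** A ** (r ** r ** A ** p) ** A)"
  have "trace (r ** r ** A) = trace ((p ** p + s *\<^sub>R (p ** p ** A ** p + p ** A ** p ** p)
      + s\<^sup>2 *\<^sub>R (p ** p ** A ** r ** A ** p + p ** A ** r ** A ** p ** p + p ** A ** r ** r ** A ** p)) ** A)"
    by (subst rr) (rule refl)
  also have "\<dots> = trace (p ** p ** A) + of_real s * (2 * trace (p ** p ** A ** p ** A)) + (of_real s)\<^sup>2 * (?T1 + ?T2 + ?T3)"
    by (simp add: dist trace_add trace_scaleR cyc)
  finally have "trace (r ** r ** A) - trace (p ** p ** A) - 2 * s * trace (p ** p ** A ** p ** A)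
     = s\<^sup>2 * (?T1 + ?T2 + ?T3)"
    by simp
  also have "cmod \<dots> = s\<^sup>2 * cmod (?T1 + ?T2 + ?T3)"
    by (simp add: norm_mult norm_power)
  also have "\<dots> \<le> s\<^sup>2 * (\<beta>\<^sup>2 * (\<beta> * L * \<beta>) * (norm A)\<^sup>2 + \<beta> * (\<beta> * L * \<beta> * \<beta>) * (norm A)\<^sup>2
      + \<beta> * (\<beta> * \<beta> * L * \<beta>) * (norm A)\<^sup>2)"
    unfolding power2_eq_square[of \<beta>]
    by (intro mult_left_mono norm_triangle_le add_mono trace_mult4_bound spectral_norm_mult_le assms(3) sp sr) simp
  also have "\<dots> = 3 * s\<^sup>2 * L * \<beta> ^ 4 * (norm A)\<^sup>2"
    by (simp add: power2_eq_square power4_eq_xxxx algebra_simps)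
  finally show ?thesis by (simp add: r_def p_def)
qed

text \<open>Telescoping: the three resolvents are exchanged one at a time, and each exchange
  produces s r A p. \<open>H\<close> is kept apart from \<open>A\<close> because it will be an
  independent copy: \<open>A\<close> is charged to L, both \<open>H\<close> to the Frobenius
  norm.\<close>

lemma trace_resolvent_quadratic_diff:
  fixes A W H :: "complex^'d^'d" and s :: real
  assumes "self_adjoint A" "self_adjoint W" "spectral_norm A \<le> L" "0 \<le> s"
  defines "Y \<equiv> W + s *\<^sub>R A"
  shows "cmod (trace (R Y ** R Y ** H ** R Y ** H) - trace (R W ** R W ** H ** R W ** H))
     \<le> 3 * s * L * \<beta> ^ 4 * (norm H)\<^sup>2"
proof -
  define r p where "r = R Y" and "p = R W"
  have sr: "spectral_norm r \<le> \<beta>" and sp: "spectral_norm p \<le> \<beta>"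
    by (simp_all add: r_def p_def spectral_norm_R)
  have saY: "self_adjoint Y" unfolding Y_def using assms by (intro self_adjoint_add self_adjoint_scaleR)
  have e1: "r - p = s *\<^sub>R (r ** A ** p)"
    using R_diff[OF saY assms(2)]
    by (simp add: r_def p_def Y_def matrix_mult_scaleR_left matrix_mult_scaleR_right algebra_simps)
  note dist = matrix_mult_scaleR_left matrix_mult_scaleR_right matrix_mult_diff_left matrix_mult_diff_right
  have "r ** r ** H ** r ** H - p ** p ** H ** p ** H
      = p ** p ** H ** (r - p) ** H + r ** (r - p) ** H ** r ** H + (r - p) ** p ** H ** r ** H"
    by (simp add: dist)
  also have "\<dots> = s *\<^sub>R ((p ** p) ** H ** (r ** A ** p) ** H + (r ** r ** A ** p) ** H ** r ** H
      + (r ** A ** p ** p) ** H ** r ** H)"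
    unfolding e1 by (simp add: dist scaleR_add_right matrix_mul_assoc)
  finally have "trace (r ** r ** H ** r ** H) - trace (p ** p ** H ** p ** H)
    = of_real s * (trace ((p ** p) ** H ** (r ** A ** p) ** H) + trace ((r ** r ** A ** p) ** H ** r ** H)
      + trace ((r ** A ** p ** p) ** H ** r ** H))"
    by (metis trace_sub trace_add trace_scaleR)
  hence "cmod (trace (r ** r ** H ** r ** H) - trace (p ** p ** H ** p ** H)) = s * cmod (trace ((p ** p) ** H ** (r ** A ** p) ** H) + trace ((r ** r ** A ** p) ** H ** r ** H)
      + trace ((r ** A ** p ** p) ** H ** r ** H))"
    using assms(4) by (simp add: norm_mult)
  also have " \<dots> \<le> s * ((\<beta> * \<beta>) * (\<beta> * L * \<beta>) * (norm H)\<^sup>2 + (\<beta> * \<beta> * L * \<beta>) * \<beta> * (norm H)\<^sup>2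
      + (\<beta> * L * \<beta> * \<beta>) * \<beta> * (norm H)\<^sup>2)"
    by (intro mult_left_mono norm_triangle_le add_mono trace_mult4_bound spectral_norm_mult_le assms(3,4) sp sr)
  also have "\<dots> = 3 * s * L * \<beta> ^ 4 * (norm H)\<^sup>2"
    by (simp add: power2_eq_square power4_eq_xxxx algebra_simps)
  finally show ?thesis by (simp add: r_def p_def)
qed

end

section \<open>Uniqueness of characteristic functions\<close>

text \<open>Levy's one-dimensional uniqueness theorem, applied to the images under \<open>f\<close>
  of the measures with density u / \<kappa>, where \<kappa> is the common mass of the weight. If
  \<kappa> = 0, the weight vanishes almost everywhere. The weight is what makes an induction over
  coordinates possible.\<close>

lemma char_uniqueness_weighted:
  fixes \<mu> \<nu> :: "'a measure" and u f :: "'a \<Rightarrow> real"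
  assumes fin: "finite_measure \<mu>" "finite_measure \<nu>" and sets: "sets \<nu> = sets \<mu>"
    and [measurable]: "u \<in> borel_measurable \<mu>" "f \<in> borel_measurable \<mu>" "B \<in> sets borel"
    and u: "\<And>x. 0 \<le> u x" "\<And>x. u x \<le> c"
    and char: "\<And>s. (\<integral>x. of_real (u x) * iexp (s * f x) \<partial>\<mu>) = (\<integral>x. of_real (u x) * iexp (s * f x) \<partial>\<nu>)"
  shows "(\<integral>x. u x * indicator B (f x) \<partial>\<mu>) = (\<integral>x. u x * indicator B (f x) \<partial>\<nu>)"
proof -
  interpret \<mu>: finite_measure \<mu> by fact
  interpret \<nu>: finite_measure \<nu> by fact
  note meas_\<nu> = measurable_cong_sets[OF sets refl]
  have [measurable]: "u \<in> borel_measurable \<nu>" "f \<in> borel_measurable \<nu>"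
    by (simp_all add: meas_\<nu>)
  have int: "integrable \<mu> u" "integrable \<nu> u"
    using u by (auto intro!: \<mu>.integrable_const_bound[of _ c] \<nu>.integrable_const_bound[of _ c])
  define \<kappa> where "\<kappa> = (\<integral>x. u x \<partial>\<mu>)"
  have \<kappa>: "\<kappa> = (\<integral>x. u x \<partial>\<nu>)"
    using char[of 0] by (simp add: \<kappa>_def)
  have "0 \<le> \<kappa>" unfolding \<kappa>_def using u by simp
  show ?thesis
  proof (cases "\<kappa> = 0")
    case True
    have "AE x in \<mu>. u x = 0" "AE x in \<nu>. u x = 0"
      using True \<kappa> u int integral_nonneg_eq_0_iff_AE[of \<mu> u] integral_nonneg_eq_0_iff_AE[of \<nu> u]
      by (simp_all add: \<kappa>_def)
    hence "(\<integral>x. u x * indicator B (f x) \<partial>\<mu>) = 0" "(\<integral>x. u x * indicator B (f x) \<partial>\<nu>) = 0"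
      by (auto intro!: integral_eq_zero_AE)
    thus ?thesis by simp
  next
    case False
    hence pos: "\<kappa> > 0" using \<open>0 \<le> \<kappa>\<close> by simp
    define D where "D \<rho> = distr (density \<rho> (\<lambda>x. ennreal (u x / \<kappa>))) borel f" for \<rho> :: "'a measure"
    have D: "real_distribution (D \<rho>)" "\<And>s. char (D \<rho>) s = (\<integral>x. of_real (u x) * iexp (s * f x) \<partial>\<rho>) / \<kappa>"
        "measure (D \<rho>) B = (\<integral>x. u x * indicator B (f x) \<partial>\<rho>) / \<kappa>"
      if \<rho>: "\<rho> = \<mu> \<or> \<rho> = \<nu>" for \<rho>
    proof -
      have [measurable]: "u \<in> borel_measurable \<rho>" "f \<in> borel_measurable \<rho>" using \<rho> by auto
      have i: "integrable \<rho> u" "(\<integral>x. u x \<partial>\<rho>) = \<kappa>" using \<rho> int \<kappa> \<kappa>_def by auto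
      have 1: "(\<integral>\<^sup>+x. ennreal (u x / \<kappa>) \<partial>\<rho>) = 1"
        using i pos u by (subst nn_integral_eq_integral) auto
      have "prob_space (density \<rho> (\<lambda>x. ennreal (u x / \<kappa>)))"
        by (rule prob_spaceI) (simp add: emeasure_density 1 cong: nn_integral_cong)
      hence "prob_space (D \<rho>)" unfolding D_def by (rule prob_space.prob_space_distr) simp
      thus rd: "real_distribution (D \<rho>)"
        by (simp add: real_distribution_def real_distribution_axioms_def D_def)
      interpret D: real_distribution "D \<rho>" by fact
      have e: "(\<integral>x. g x \<partial>D \<rho>) = (\<integral>x. (u x / \<kappa>) *\<^sub>R g (f x) \<partial>\<rho>)"
        if [measurable]: "g \<in> borel_measurable borel" for g :: "real \<Rightarrow> 'c::{banach, second_countable_topology}"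
        unfolding D_def using u pos by (simp add: integral_distr integral_density)
      show "char (D \<rho>) s = (\<integral>x. of_real (u x) * iexp (s * f x) \<partial>\<rho>) / \<kappa>" for s
        unfolding char_def by (simp add: e scaleR_conv_of_real)
      have "measure (D \<rho>) B = (\<integral>x. indicator B x \<partial>D \<rho>)"
        using D.emeasure_finite by (simp add: D_def)
      also have "\<dots> = (\<integral>x. u x * indicator B (f x) \<partial>\<rho>) / \<kappa>"
        by (subst e) simp_all
      finally show "measure (D \<rho>) B = (\<integral>x. u x * indicator B (f x) \<partial>\<rho>) / \<kappa>" .
    qed
    have "D \<mu> = D \<nu>"
    proof (rule Levy_uniqueness)
      show "char (D \<mu>) = char (D \<nu>)" 
        by (rule ext) (simp only: D(2)[OF disjI1[OF refl]] D(2)[OF disjI2[OF refl]] char)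
    qed (auto simp: D)
    thus ?thesis using D(3)[of \<mu>] D(3)[of \<nu>] pos by simp
  qed
qed

text \<open>Coordinates are converted one by one from frequencies to indicators, each time by the
  weighted one-dimensional statement. Once all coordinates are converted, the measures agree on open
  boxes, which are stable under intersection and generate the Borel sets.\<close>

lemma char_uniqueness_euclidean:
  fixes \<mu> \<nu> :: "'a::euclidean_space measure"
  assumes prob: "prob_space \<mu>" "prob_space \<nu>" and sets[measurable_cong]: "sets \<mu> = sets borel" "sets \<nu> = sets borel"
    and char: "\<And>t. (\<integral>x. iexp (t \<bullet> x) \<partial>\<mu>) = (\<integral>x. iexp (t \<bullet> x) \<partial>\<nu>)"
  shows "\<mu> = \<nu>"
proof -
  interpret \<mu>: prob_space \<mu> by fact
  interpret \<nu>: prob_space \<nu> by fact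
  define w :: "('a \<Rightarrow> real set) \<Rightarrow> 'a set \<Rightarrow> 'a \<Rightarrow> real" where
    "w B J x = (\<Prod>b\<in>J. indicator (B b) (x \<bullet> b))" for B J x
  have w01: "0 \<le> w B J x" "w B J x \<le> 1" for B J x
    unfolding w_def by (auto intro!: prod_nonneg prod_le_1)
  have wm[measurable]: "w B J \<in> borel_measurable borel" if "\<And>b. B b \<in> sets borel" for B J
    unfolding w_def using that by measurable
  have int: "integrable \<rho> h" if "\<rho> = \<mu> \<or> \<rho> = \<nu>" "h \<in> borel_measurable borel" "\<And>x. norm (h x) \<le> c"
    for \<rho> and h :: "'a \<Rightarrow> 'c::{banach, second_countable_topology}" and c
  proof -
    have "h \<in> borel_measurable \<rho>" using that sets measurable_cong_sets by blast
    moreover have "finite_measure \<rho>"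
      using that(1) \<mu>.finite_measure_axioms \<nu>.finite_measure_axioms by blast
    ultimately show ?thesis using that(3) by (intro finite_measure.integrable_const_bound AE_I2)
  qed
  have key: "(\<integral>x. of_real (w B J x) * iexp (t \<bullet> x) \<partial>\<mu>) = (\<integral>x. of_real (w B J x) * iexp (t \<bullet> x) \<partial>\<nu>)"
    if "finite J" "\<And>b. B b \<in> sets borel" for J t and B :: "'a \<Rightarrow> real set"
    using that(1)
  proof (induction J arbitrary: t)
    case empty
    thus ?case using char by (simp add: w_def)
  next
    case (insert b J)
    note [measurable] = wm[OF that(2)] that(2)
    have W: "w B (insert b J) x = w B J x * indicator (B b) (x \<bullet> b)" for x
      using insert by (simp add: w_def mult.commute)
    have iw: "integrable \<rho> (\<lambda>x. of_real (w B J x) * iexp (t \<bullet> x))" if "\<rho> = \<mu> \<or> \<rho> = \<nu>" for \<rho> t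
      by (rule int[OF that, of _ 1]) (auto simp: norm_mult w01)
    \<comment> \<open>An exponential is no density, hence the detour through the nonnegative weight
      1 + cos with a free phase \<theta>.\<close>
    have c1: "(\<integral>x. (w B J x * (1 + cos (t \<bullet> x + \<theta>))) * indicator (B b) (x \<bullet> b) \<partial>\<mu>)
        = (\<integral>x. (w B J x * (1 + cos (t \<bullet> x + \<theta>))) * indicator (B b) (x \<bullet> b) \<partial>\<nu>)" for t \<theta>
    proof (rule char_uniqueness_weighted[where c = 2])
      fix s
      \<comment> \<open>Writing the cosine as half a sum of exponentials reduces the hypothesis to
        the induction hypothesis at the frequencies s b, t + s b and - t + s b.\<close>
      have "of_real (w B J x * (1 + cos (t \<bullet> x + \<theta>))) * iexp (s * (x \<bullet> b))
         = of_real (w B J x) * iexp ((s *\<^sub>R b) \<bullet> x)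
         + ((iexp \<theta> / 2) * (of_real (w B J x) * iexp ((t + s *\<^sub>R b) \<bullet> x))
         + (iexp (- \<theta>) / 2) * (of_real (w B J x) * iexp ((- t + s *\<^sub>R b) \<bullet> x)))" for x
      proof -
        have e1: "iexp ((s *\<^sub>R b) \<bullet> x) = iexp (s * (x \<bullet> b))"
          by (simp add: inner_commute)
        have e2: "iexp ((t + s *\<^sub>R b) \<bullet> x) = iexp (t \<bullet> x) * iexp (s * (x \<bullet> b))"
          unfolding exp_add[symmetric] inner_add_left by (simp add: inner_commute distrib_left)
        have e3: "iexp ((- t + s *\<^sub>R b) \<bullet> x) = iexp (- (t \<bullet> x)) * iexp (s * (x \<bullet> b))"
          unfolding exp_add[symmetric] inner_add_left by (simp add: inner_commute right_diff_distrib)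
        have e4: "of_real (cos (t \<bullet> x + \<theta>)) = (iexp (t \<bullet> x) * iexp \<theta> + iexp (- (t \<bullet> x)) * iexp (- \<theta>)) / 2"
          unfolding cos_of_real[symmetric] cos_exp_eq by (simp add: exp_add[symmetric] distrib_left)
        have "W * (1 + (E * T + E' * T') / 2) * S = W * S + (T / 2 * (W * (E * S)) + T' / 2 * (W * (E' * S)))"
          for W E T E' T' S :: complex by (simp add: field_simps)
        thus ?thesis unfolding of_real_mult[of "w B J x"] of_real_add[of 1] of_real_1 e1 e2 e3 e4 .
      qed
      thus "(\<integral>x. of_real (w B J x * (1 + cos (t \<bullet> x + \<theta>))) * iexp (s * (x \<bullet> b)) \<partial>\<mu>)
        = (\<integral>x. of_real (w B J x * (1 + cos (t \<bullet> x + \<theta>))) * iexp (s * (x \<bullet> b)) \<partial>\<nu>)"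
        by (simp only: Bochner_Integration.integral_add integrable_mult_right iw Bochner_Integration.integrable_add
            integral_mult_right_zero insert.IH simp_thms)
    next
      fix x
      have "0 \<le> 1 + cos (t \<bullet> x + \<theta>)" using cos_ge_minus_one[of "t \<bullet> x + \<theta>"] by linarith
      thus "0 \<le> w B J x * (1 + cos (t \<bullet> x + \<theta>))" by (intro mult_nonneg_nonneg w01)
      have "w B J x * (1 + cos (t \<bullet> x + \<theta>)) \<le> 1 * 2"
        using \<open>0 \<le> 1 + cos (t \<bullet> x + \<theta>)\<close> by (intro mult_mono w01) auto
      thus "w B J x * (1 + cos (t \<bullet> x + \<theta>)) \<le> 2" by simp
    qed (auto simp: sets \<mu>.finite_measure_axioms \<nu>.finite_measure_axioms)
    have int2: "integrable \<rho> (w B (insert b J))" "integrable \<rho> (\<lambda>x. w B (insert b J) x * cos (t \<bullet> x + \<theta>))"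
      if "\<rho> = \<mu> \<or> \<rho> = \<nu>" for \<rho> t \<theta>
      by (rule int[OF that, of _ 1]; use w01 in \<open>auto simp: abs_mult mult_le_one\<close>)+
    have c2: "(\<integral>x. w B (insert b J) x \<partial>\<mu>) + (\<integral>x. w B (insert b J) x * cos (t \<bullet> x + \<theta>) \<partial>\<mu>)
       = (\<integral>x. w B (insert b J) x \<partial>\<nu>) + (\<integral>x. w B (insert b J) x * cos (t \<bullet> x + \<theta>) \<partial>\<nu>)" for t \<theta>
      using c1[of t \<theta>] unfolding Bochner_Integration.integral_add[OF int2[OF disjI1[OF refl]], symmetric]
        Bochner_Integration.integral_add[OF int2[OF disjI2[OF refl]], symmetric]
      by (simp add: W algebra_simps)
    \<comment> \<open>At t = 0 and \<theta> = 0 the weight 1 + cos equals 2, so the masses without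
      cosine agree and can be subtracted.\<close>
    have c3: "(\<integral>x. w B (insert b J) x * cos (t \<bullet> x + \<theta>) \<partial>\<mu>) = (\<integral>x. w B (insert b J) x * cos (t \<bullet> x + \<theta>) \<partial>\<nu>)" for t \<theta>
      using c2[of t \<theta>] c2[of 0 0] by simp
    \<comment> \<open>The phase - pi/2 turns the cosine into the sine, which restores the complex
      exponential.\<close>
    have e: "of_real (w B (insert b J) x) * iexp (t \<bullet> x) = of_real (w B (insert b J) x * cos (t \<bullet> x + 0))
        + \<i> * of_real (w B (insert b J) x * cos (t \<bullet> x + (- (pi/2))))" for x
      by (simp add: cis_conv_exp[symmetric] complex_eq_iff cos_diff)
    have i3: "integrable \<rho> (\<lambda>x. complex_of_real (w B (insert b J) x * cos (t \<bullet> x + \<theta>)))" if "\<rho> = \<mu> \<or> \<rho> = \<nu>" for \<rho> t \<theta>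
      by (intro integrable_of_real int2 that)
    show ?case
      unfolding e by (simp only: Bochner_Integration.integral_add integrable_mult_right i3 integral_mult_right_zero
          integral_complex_of_real c3 simp_thms)
  qed
  have box_eq: "emeasure \<mu> (box l r) = emeasure \<nu> (box l r)" for l r
  proof -
    define B where "B b = {l \<bullet> b <..< r \<bullet> b}" for b
    have B: "\<And>b. B b \<in> sets borel" by (simp add: B_def)
    have wi: "w B Basis x = indicator (box l r) x" for x
    proof (cases "x \<in> box l r")
      case False
      then obtain b where "b \<in> Basis" "x \<bullet> b \<notin> B b" by (auto simp: mem_box B_def)
      thus ?thesis using False by (auto simp: w_def intro!: bexI[of _ b])
    qed (simp add: w_def B_def mem_box)
    have "of_real (\<integral>x. w B Basis x \<partial>\<mu>) = (of_real (\<integral>x. w B Basis x \<partial>\<nu>) :: complex)"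
      using key[of Basis B 0] B by simp
    hence "measure \<mu> (box l r) = measure \<nu> (box l r)"
      unfolding wi of_real_eq_iff by (simp add: sets)
    thus ?thesis by (simp add: \<mu>.emeasure_eq_measure \<nu>.emeasure_eq_measure)
  qed
  show ?thesis
  proof (rule measure_eqI_generator_eq[where E = "range (\<lambda>(a, b). box a b)" and \<Omega> = UNIV
      and A = "\<lambda>n::nat. box (- (real n *\<^sub>R One)) (real n *\<^sub>R One)"])
    show "Int_stable (range (\<lambda>(a, b). box a b :: 'a set))"
      by (auto simp: Int_stable_def box_Int_box)
    show "(\<Union>n::nat. box (- (real n *\<^sub>R One)) (real n *\<^sub>R One)) = (UNIV :: 'a set)"
      using UN_box_eq_UNIV by auto
  qed (auto simp: sets box_eq borel_eq_box)
qed

section \<open>Integration, independence and Gaussian variables\<close>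

text \<open>Difference quotients converge pointwise and, by the mean value inequality, are dominated
  by \<open>w\<close>. Dominated convergence is applied along arbitrary sequences tending to
  \<open>t\<^sub>0\<close>.\<close>

lemma has_vector_derivative_integral:
  fixes f f' :: "real \<Rightarrow> 'a \<Rightarrow> 'b::{banach, second_countable_topology}"
  assumes int: "\<And>t. integrable M (f t)" and meas: "f' t\<^sub>0 \<in> borel_measurable M"
    and w: "integrable M w"
    and deriv: "\<And>t x. x \<in> space M \<Longrightarrow> ((\<lambda>t. f t x) has_vector_derivative f' t x) (at t)"
    and bound: "\<And>t x. x \<in> space M \<Longrightarrow> norm (f' t x) \<le> w x"
  shows "((\<lambda>t. \<integral>x. f t x \<partial>M) has_vector_derivative (\<integral>x. f' t\<^sub>0 x \<partial>M)) (at t\<^sub>0)"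
proof -
  define q where "q t x = (f t x - f t\<^sub>0 x) /\<^sub>R (t - t\<^sub>0)" for t x
  have q_lim: "((\<lambda>t. q t x) \<longlongrightarrow> f' t\<^sub>0 x) (at t\<^sub>0)" if "x \<in> space M" for x
  proof -
    have "((\<lambda>t. norm (f t x - f t\<^sub>0 x - (t - t\<^sub>0) *\<^sub>R f' t\<^sub>0 x) / norm (t - t\<^sub>0)) \<longlongrightarrow> 0) (at t\<^sub>0)"
      using deriv[OF that, of t\<^sub>0] unfolding has_vector_derivative_def has_derivative_iff_norm by simp
    moreover have "\<forall>\<^sub>F t in at t\<^sub>0. norm (f t x - f t\<^sub>0 x - (t - t\<^sub>0) *\<^sub>R f' t\<^sub>0 x) / norm (t - t\<^sub>0) = norm (q t x - f' t\<^sub>0 x)"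
    proof (rule eventually_at_filter[THEN iffD2, OF always_eventually, OF allI, OF impI])
      fix t assume "t \<noteq> t\<^sub>0"
      hence "q t x - f' t\<^sub>0 x = (f t x - f t\<^sub>0 x - (t - t\<^sub>0) *\<^sub>R f' t\<^sub>0 x) /\<^sub>R (t - t\<^sub>0)"
        by (simp add: q_def scaleR_diff_right)
      thus "t \<in> UNIV \<longrightarrow> norm (f t x - f t\<^sub>0 x - (t - t\<^sub>0) *\<^sub>R f' t\<^sub>0 x) / norm (t - t\<^sub>0) = norm (q t x - f' t\<^sub>0 x)"
        by (simp add: divide_inverse mult.commute)
    qed
    ultimately have "((\<lambda>t. norm (q t x - f' t\<^sub>0 x)) \<longlongrightarrow> 0) (at t\<^sub>0)"
      by (rule Lim_transform_eventually)
    thus ?thesis by (simp add: tendsto_norm_zero_iff LIM_zero_iff)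
  qed
  have q_bound: "norm (q t x) \<le> w x" if x: "x \<in> space M" for t x
  proof -
    have "norm (f t x - f t\<^sub>0 x) \<le> w x * norm (t - t\<^sub>0)"
    proof (rule differentiable_bound[where S = UNIV and f' = "\<lambda>t h. h *\<^sub>R f' t x"])
      show "onorm (\<lambda>h. h *\<^sub>R f' t x) \<le> w x" for t
        using bound[OF x, of t] by (intro onorm_le) (simp add: mult.commute mult_left_mono)
    qed (use deriv[OF x] in \<open>auto simp: has_vector_derivative_def\<close>)
    moreover have "norm (q t x) = norm (f t x - f t\<^sub>0 x) / norm (t - t\<^sub>0)"
      by (simp add: q_def divide_inverse mult.commute)
    ultimately show ?thesis using order_trans[OF norm_ge_zero bound[OF x]]
      by (cases "t = t\<^sub>0") (auto simp: pos_divide_le_eq)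
  qed
  have qm: "q t \<in> borel_measurable M" for t
    unfolding q_def using int by (intro borel_measurable_scaleR borel_measurable_diff) auto
  have "((\<lambda>t. \<integral>x. q t x \<partial>M) \<longlongrightarrow> (\<integral>x. f' t\<^sub>0 x \<partial>M)) (at t\<^sub>0)"
    unfolding tendsto_at_iff_sequentially
  proof (intro allI impI)
    fix T assume T: "\<forall>i. T i \<in> UNIV - {t\<^sub>0}" "T \<longlonglongrightarrow> t\<^sub>0"
    show "((\<lambda>t. \<integral>x. q t x \<partial>M) \<circ> T) \<longlonglongrightarrow> (\<integral>x. f' t\<^sub>0 x \<partial>M)"
      unfolding o_def
    proof (rule integral_dominated_convergence[OF meas qm w])
      show "AE x in M. (\<lambda>i. q (T i) x) \<longlonglongrightarrow> f' t\<^sub>0 x"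
        using q_lim T unfolding tendsto_at_iff_sequentially o_def by (intro AE_I2) auto
      show "AE x in M. norm (q (T i) x) \<le> w x" for i
        by (intro AE_I2 q_bound)
    qed
  qed
  moreover have "(\<integral>x. q t x \<partial>M) = ((\<integral>x. f t x \<partial>M) - (\<integral>x. f t\<^sub>0 x \<partial>M)) /\<^sub>R (t - t\<^sub>0)" for t
    unfolding q_def using int by simp
  ultimately have lim: "((\<lambda>t. ((\<integral>x. f t x \<partial>M) - (\<integral>x. f t\<^sub>0 x \<partial>M)) /\<^sub>R (t - t\<^sub>0) - (\<integral>x. f' t\<^sub>0 x \<partial>M)) \<longlongrightarrow> 0) (at t\<^sub>0)"
    by (simp add: LIM_zero)
  have "((\<lambda>t. norm ((\<integral>x. f t x \<partial>M) - (\<integral>x. f t\<^sub>0 x \<partial>M) - (t - t\<^sub>0) *\<^sub>R (\<integral>x. f' t\<^sub>0 x \<partial>M)) / norm (t - t\<^sub>0)) \<longlongrightarrow> 0) (at t\<^sub>0)"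
  proof (rule Lim_transform_eventually[OF tendsto_norm_zero[OF lim]])
    show "\<forall>\<^sub>F t in at t\<^sub>0. norm (((\<integral>x. f t x \<partial>M) - (\<integral>x. f t\<^sub>0 x \<partial>M)) /\<^sub>R (t - t\<^sub>0) - (\<integral>x. f' t\<^sub>0 x \<partial>M))
      = norm ((\<integral>x. f t x \<partial>M) - (\<integral>x. f t\<^sub>0 x \<partial>M) - (t - t\<^sub>0) *\<^sub>R (\<integral>x. f' t\<^sub>0 x \<partial>M)) / norm (t - t\<^sub>0)"
    proof (rule eventually_at_filter[THEN iffD2, OF always_eventually, OF allI, OF impI])
      fix t assume "t \<noteq> t\<^sub>0"
      hence "((\<integral>x. f t x \<partial>M) - (\<integral>x. f t\<^sub>0 x \<partial>M)) /\<^sub>R (t - t\<^sub>0) - (\<integral>x. f' t\<^sub>0 x \<partial>M)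
        = ((\<integral>x. f t x \<partial>M) - (\<integral>x. f t\<^sub>0 x \<partial>M) - (t - t\<^sub>0) *\<^sub>R (\<integral>x. f' t\<^sub>0 x \<partial>M)) /\<^sub>R (t - t\<^sub>0)"
        by (simp add: scaleR_diff_right)
      thus "t \<in> UNIV \<longrightarrow> norm (((\<integral>x. f t x \<partial>M) - (\<integral>x. f t\<^sub>0 x \<partial>M)) /\<^sub>R (t - t\<^sub>0) - (\<integral>x. f' t\<^sub>0 x \<partial>M))
      = norm ((\<integral>x. f t x \<partial>M) - (\<integral>x. f t\<^sub>0 x \<partial>M) - (t - t\<^sub>0) *\<^sub>R (\<integral>x. f' t\<^sub>0 x \<partial>M)) / norm (t - t\<^sub>0)"
        by (simp add: divide_inverse mult.commute)
    qed
  qed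
  thus ?thesis
    unfolding has_vector_derivative_def has_derivative_iff_norm by (simp add: bounded_linear_scaleR_left)
qed

text \<open>The joint law is the product of the marginal laws, so Fubini allows integrating out
  \<open>U\<close> while \<open>V\<close> is frozen. The inner integral thereby runs over an
  independent copy of \<open>U\<close>.\<close>

lemma (in prob_space) indep_var_integral_prod:
  fixes \<phi> :: "'c \<times> 'c \<Rightarrow> 'e::{banach, second_countable_topology}"
  assumes indep: "indep_var S U T V" and [measurable]: "\<phi> \<in> borel_measurable (S \<Otimes>\<^sub>M T)"
    and int: "integrable M (\<lambda>\<omega>. \<phi> (U \<omega>, V \<omega>))"
  shows "(\<integral>\<omega>. \<phi> (U \<omega>, V \<omega>) \<partial>M) = (\<integral>\<omega>. (\<integral>\<omega>'. \<phi> (U \<omega>', V \<omega>) \<partial>M) \<partial>M)"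
proof -
  have [measurable]: "U \<in> measurable M S" "V \<in> measurable M T"
    using indep unfolding indep_var_distribution_eq by auto
  have eq: "distr M S U \<Otimes>\<^sub>M distr M T V = distr M (S \<Otimes>\<^sub>M T) (\<lambda>\<omega>. (U \<omega>, V \<omega>))"
    using indep unfolding indep_var_distribution_eq by auto
  interpret U: prob_space "distr M S U" by (rule prob_space_distr) simp
  interpret V: prob_space "distr M T V" by (rule prob_space_distr) simp
  interpret P: pair_prob_space "distr M S U" "distr M T V" ..
  have int': "integrable (distr M S U \<Otimes>\<^sub>M distr M T V) \<phi>"
    unfolding eq using int by (simp add: integrable_distr_eq)
  have "(\<integral>\<omega>. \<phi> (U \<omega>, V \<omega>) \<partial>M) = (\<integral>p. \<phi> p \<partial>(distr M S U \<Otimes>\<^sub>M distr M T V))"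
    unfolding eq by (simp add: integral_distr)
  also have "\<dots> = (\<integral>v. (\<integral>u. \<phi> (u, v) \<partial>distr M S U) \<partial>distr M T V)"
    using P.integral_snd[of "\<lambda>u v. \<phi> (u, v)"] int' by simp
  also have "\<dots> = (\<integral>\<omega>. (\<integral>u. \<phi> (u, V \<omega>) \<partial>distr M S U) \<partial>M)"
    by (rule integral_distr) measurable
  also have "\<dots> = (\<integral>\<omega>. (\<integral>\<omega>'. \<phi> (U \<omega>', V \<omega>) \<partial>M) \<partial>M)"
  proof (rule Bochner_Integration.integral_cong[OF refl])
    fix \<omega> assume "\<omega> \<in> space M"
    hence [measurable]: "V \<omega> \<in> space T" by (rule measurable_space[rotated]) simp
    show "(\<integral>u. \<phi> (u, V \<omega>) \<partial>distr M S U) = (\<integral>\<omega>'. \<phi> (U \<omega>', V \<omega>) \<partial>M)"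
      by (rule integral_distr) measurable
  qed
  finally show ?thesis .
qed

lemma (in prob_space) indep_var_sum_others:
  fixes X :: "'i \<Rightarrow> 'a \<Rightarrow> 'b::{real_normed_vector, second_countable_topology}"
  assumes I: "finite I" "i \<notin> I" and indep: "indep_vars (\<lambda>_. borel) X (insert i I)"
  shows "indep_var borel (X i) borel (\<lambda>\<omega>. \<Sum>i\<in>I. X i \<omega>)"
proof -
  have "indep_var
    borel ((\<lambda>f. f i) \<circ> (\<lambda>\<omega>. restrict (\<lambda>i. X i \<omega>) {i}))
    borel ((\<lambda>f. \<Sum>i\<in>I. f i) \<circ> (\<lambda>\<omega>. restrict (\<lambda>i. X i \<omega>) I))"
    using I by (intro indep_var_compose[OF indep_var_restrict[OF indep]]) auto
  also have "(\<lambda>f. f i) \<circ> (\<lambda>\<omega>. restrict (\<lambda>i. X i \<omega>) {i}) = X i" by auto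
  also have "(\<lambda>f. \<Sum>i\<in>I. f i) \<circ> (\<lambda>\<omega>. restrict (\<lambda>i. X i \<omega>) I) = (\<lambda>\<omega>. \<Sum>i\<in>I. X i \<omega>)"
    by (auto cong: rev_conj_cong)
  finally show ?thesis .
qed

section \<open>Real Gaussian variables: second moments, shifts and characteristic functions\<close>

lemma gaussian_rv_integrable_square:
  assumes "prob_space M" "gaussian_rv M Y"
  shows "integrable M (\<lambda>\<omega>. (Y \<omega>)\<^sup>2)"
proof -
  interpret prob_space M by fact
  have [measurable]: "Y \<in> borel_measurable M" using assms by (simp add: gaussian_rv_def)
  obtain \<mu> where "(AE \<omega> in M. Y \<omega> = \<mu>) \<or>
      (\<exists>\<sigma>>0. distributed M lborel Y (\<lambda>x. ennreal (normal_density \<mu> \<sigma> x)))"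
    using assms by (auto simp: gaussian_rv_def)
  thus ?thesis
  proof (elim disjE exE conjE)
    assume "AE \<omega> in M. Y \<omega> = \<mu>"
    thus ?thesis by (intro integrable_const_bound[of _ "\<mu>\<^sup>2"]) (auto elim: eventually_mono)
  next
    fix \<sigma> :: real assume "0 < \<sigma>" and d: "distributed M lborel Y (\<lambda>x. ennreal (normal_density \<mu> \<sigma> x))"
    \<comment> \<open>This is x^2 = (x - \<mu>)^2 + 2 \<mu> x - \<mu>^2, which reduces the claim to
      the centered second moment and the mean.\<close>
    have "integrable lborel (\<lambda>x. normal_density \<mu> \<sigma> x * (x - \<mu>)\<^sup>2 + 2 * \<mu> * (normal_density \<mu> \<sigma> x * x) - \<mu>\<^sup>2 * normal_density \<mu> \<sigma> x)"
      using \<open>0 < \<sigma>\<close> by (intro Bochner_Integration.integrable_add Bochner_Integration.integrable_diff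
        integrable_mult_right integrable_normal_moment integrable_normal_moment_nz_1 integrable_normal_density)
    also have "(\<lambda>x. normal_density \<mu> \<sigma> x * (x - \<mu>)\<^sup>2 + 2 * \<mu> * (normal_density \<mu> \<sigma> x * x) - \<mu>\<^sup>2 * normal_density \<mu> \<sigma> x)
       = (\<lambda>x. normal_density \<mu> \<sigma> x * x\<^sup>2)"
      by (rule ext) (simp add: power2_eq_square algebra_simps)
    finally show ?thesis
      using distributed_integrable[OF d, of "\<lambda>x. x\<^sup>2"] by simp
  qed
qed

lemma gaussian_rv_diff_const:
  assumes "prob_space M" "gaussian_rv M Y"
  shows "gaussian_rv M (\<lambda>\<omega>. Y \<omega> - c)"
proof -
  interpret prob_space M by fact
  have [measurable]: "Y \<in> borel_measurable M" using assms by (simp add: gaussian_rv_def)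
  obtain \<mu> where "(AE \<omega> in M. Y \<omega> = \<mu>) \<or>
      (\<exists>\<sigma>>0. distributed M lborel Y (\<lambda>x. ennreal (normal_density \<mu> \<sigma> x)))"
    using assms by (auto simp: gaussian_rv_def)
  thus ?thesis
  proof (elim disjE exE conjE)
    assume "AE \<omega> in M. Y \<omega> = \<mu>"
    hence "AE \<omega> in M. Y \<omega> - c = \<mu> - c" by (auto elim: eventually_mono)
    thus ?thesis by (auto simp: gaussian_rv_def)
  next
    fix \<sigma> :: real assume \<sigma>: "0 < \<sigma>" and d: "distributed M lborel Y (\<lambda>x. ennreal (normal_density \<mu> \<sigma> x))"
    have "distributed M lborel (\<lambda>\<omega>. Y \<omega> - c) (\<lambda>x. ennreal (normal_density (\<mu> - c) \<sigma> x))"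
      using normal_density_affine[OF d \<sigma>, of 1 "- c"] by simp
    thus ?thesis using \<sigma> unfolding gaussian_rv_def by auto
  qed
qed

text \<open>Evaluation at 1 suffices, because the lemma is applied to every functional a . G and
  \<open>a\<close> can absorb a scaling. Using the second moment as the parameter gives the
  degenerate and the normal case the same formula.\<close>

lemma gaussian_rv_char:
  assumes "prob_space M" "gaussian_rv M Y" and mean: "(\<integral>\<omega>. Y \<omega> \<partial>M) = 0"
  shows "(\<integral>\<omega>. iexp (Y \<omega>) \<partial>M) = of_real (exp (- (\<integral>\<omega>. (Y \<omega>)\<^sup>2 \<partial>M) / 2))"
proof -
  interpret prob_space M by fact
  have [measurable]: "Y \<in> borel_measurable M" using assms by (simp add: gaussian_rv_def)
  obtain \<mu> where "(AE \<omega> in M. Y \<omega> = \<mu>) \<or>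
      (\<exists>\<sigma>>0. distributed M lborel Y (\<lambda>x. ennreal (normal_density \<mu> \<sigma> x)))"
    using assms by (auto simp: gaussian_rv_def)
  thus ?thesis
  proof (elim disjE exE conjE)
    assume ae: "AE \<omega> in M. Y \<omega> = \<mu>"
    have "(\<integral>\<omega>. Y \<omega> \<partial>M) = (\<integral>\<omega>. \<mu> \<partial>M)" using ae by (intro integral_cong_AE) auto
    hence "\<mu> = 0" using mean by (simp add: prob_space)
    have "(\<integral>\<omega>. iexp (Y \<omega>) \<partial>M) = (\<integral>\<omega>. 1 \<partial>M)"
      using ae \<open>\<mu> = 0\<close> by (intro integral_cong_AE) auto
    moreover have "(\<integral>\<omega>. (Y \<omega>)\<^sup>2 \<partial>M) = (\<integral>\<omega>. 0 \<partial>M)"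
      using ae \<open>\<mu> = 0\<close> by (intro integral_cong_AE) auto
    ultimately show ?thesis by (simp add: prob_space)
  next
    fix \<sigma> :: real assume \<sigma>: "0 < \<sigma>" and d: "distributed M lborel Y (\<lambda>x. ennreal (normal_density \<mu> \<sigma> x))"
    have "\<mu> = 0" using normal_distributed_expectation[OF \<sigma> d] mean by simp
    have var: "(\<integral>\<omega>. (Y \<omega>)\<^sup>2 \<partial>M) = \<sigma>\<^sup>2"
      using normal_distributed_variance[OF \<sigma> d] mean by simp
    have d1: "distributed M lborel (\<lambda>\<omega>. Y \<omega> / \<sigma>) (\<lambda>x. ennreal (std_normal_density x))"
      using normal_standard_normal_convert[OF \<sigma>, of Y \<mu>] d \<open>\<mu> = 0\<close> by simp
    have dist: "distr M lborel (\<lambda>\<omega>. Y \<omega> / \<sigma>) = density lborel (\<lambda>x. ennreal (std_normal_density x))"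
      using d1 by (simp add: distributed_def)
    have "(\<integral>\<omega>. iexp (Y \<omega>) \<partial>M) = (\<integral>\<omega>. iexp (\<sigma> * (Y \<omega> / \<sigma>)) \<partial>M)" using \<sigma> by simp
    also have "\<dots> = (\<integral>x. iexp (\<sigma> * x) \<partial>distr M lborel (\<lambda>\<omega>. Y \<omega> / \<sigma>))"
      by (rule integral_distr[symmetric]) simp_all
    also have "\<dots> = char std_normal_distribution \<sigma>"
      unfolding dist char_def ..
    also have "\<dots> = of_real (exp (- (\<sigma>\<^sup>2) / 2))" by (simp add: char_std_normal_distribution)
    finally show ?thesis by (simp add: var)
  qed
qed

lemma (in prob_space) integrable_of_norm_square:
  fixes H :: "'a \<Rightarrow> 'b::{second_countable_topology, banach}"
  assumes [measurable]: "H \<in> borel_measurable M" and int: "integrable M (\<lambda>\<omega>. (norm (H \<omega>))\<^sup>2)"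
  shows "integrable M H"
proof (rule Bochner_Integration.integrable_bound)
  show "integrable M (\<lambda>\<omega>. 1 + (norm (H \<omega>))\<^sup>2)" using int by simp
  have "norm (H \<omega>) \<le> 1 + (norm (H \<omega>))\<^sup>2" for \<omega>
  proof -
    have "0 \<le> (norm (H \<omega>) - 1)\<^sup>2" by simp
    also have "\<dots> = (norm (H \<omega>))\<^sup>2 + 1 - 2 * norm (H \<omega>)" by (simp add: power2_diff)
    finally show ?thesis using norm_ge_zero[of "H \<omega>"] by linarith
  qed
  thus "AE \<omega> in M. norm (H \<omega>) \<le> norm (1 + (norm (H \<omega>))\<^sup>2)"
    by (intro AE_I2) simp
qed simp

section \<open>Gaussian integration by parts\<close>

lemma trace_uminus: "trace (- A) = - trace (A :: complex^'d^'d)"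
  by (simp add: trace_def sum_negf)

lemma measurable_matrix_mult [measurable (raw)]:
  fixes f g :: "'a \<Rightarrow> complex^'d^'d"
  assumes "f \<in> borel_measurable M" "g \<in> borel_measurable M"
  shows "(\<lambda>x. f x ** g x) \<in> borel_measurable M"
  by (rule borel_measurable_continuous_Pair[OF assms]) (intro matrix_mult.continuous_on continuous_intros)

lemma measurable_trace [measurable (raw)]:
  fixes f :: "'a \<Rightarrow> complex^'d^'d"
  assumes "f \<in> borel_measurable M"
  shows "(\<lambda>x. trace (f x)) \<in> borel_measurable M"
  using assms by (rule measurable_compose)
    (intro borel_measurable_continuous_onI linear_continuous_on bounded_linear_trace)

lemma (in pair_prob_space) integral_mult_pair:
  fixes f g :: "_ \<Rightarrow> complex"
  assumes f: "integrable M1 f" and g: "integrable M2 g"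
  shows "(\<integral>p. f (fst p) * g (snd p) \<partial>(M1 \<Otimes>\<^sub>M M2)) = (\<integral>x. f x \<partial>M1) * (\<integral>y. g y \<partial>M2)"
proof -
  have [measurable]: "f \<in> borel_measurable M1" "g \<in> borel_measurable M2" using f g by auto
  have "integrable (M1 \<Otimes>\<^sub>M M2) (\<lambda>p. f (fst p) * g (snd p))"
    by (rule Fubini_integrable) (use f g in \<open>auto simp: norm_mult\<close>)
  from integral_fst'[OF this] show ?thesis by simp
qed

lemma (in pair_prob_space) integrable_fst_snd:
  fixes f :: "_ \<Rightarrow> real" and g :: "_ \<Rightarrow> real"
  shows "integrable M1 f \<Longrightarrow> integrable (M1 \<Otimes>\<^sub>M M2) (\<lambda>p. f (fst p))"
    and "integrable M2 g \<Longrightarrow> integrable (M1 \<Otimes>\<^sub>M M2) (\<lambda>p. g (snd p))"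
  by (rule Fubini_integrable; auto simp: M2.prob_space)+

text \<open>The real inner product of complex matrices sums the products of real parts and of
  imaginary parts, so each functional is one of the combinations covered by
  \<open>jointly_gaussian\<close>.\<close>

lemma gaussian_matrix_inner:
  assumes "gaussian_matrix N Z"
  shows "gaussian_rv N (\<lambda>\<omega>. (a :: complex^'d^'d) \<bullet> Z \<omega>)"
proof -
  define Y :: "('d \<times> 'd + 'd \<times> 'd) \<Rightarrow> 'a \<Rightarrow> real" where
    "Y = case_sum (\<lambda>(i, j) \<omega>. Re (Z \<omega> $ i $ j)) (\<lambda>(i, j) \<omega>. Im (Z \<omega> $ i $ j))"
  define c :: "('d \<times> 'd + 'd \<times> 'd) \<Rightarrow> real" where
    "c = case_sum (\<lambda>(i, j). Re (a $ i $ j)) (\<lambda>(i, j). Im (a $ i $ j))"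
  have "(\<Sum>k\<in>UNIV. c k * Y k \<omega>) = a \<bullet> Z \<omega>" for \<omega>
    unfolding UNIV_Plus_UNIV[symmetric]
    by (simp add: sum.Plus Y_def c_def inner_vec_def inner_complex_def sum.distrib
        sum.cartesian_product case_prod_beta del: UNIV_Plus_UNIV)
  moreover have "gaussian_rv N (\<lambda>\<omega>. \<Sum>k\<in>UNIV. c k * Y k \<omega>)"
    using assms unfolding gaussian_matrix_def jointly_gaussian_def Y_def by blast
  ultimately show ?thesis by simp
qed

context resolvent
begin

text \<open>Crude dimension-dependent majorants, meant for integrability and domination.\<close>

lemma trace_R_products_bound:
  fixes A B C D E :: "complex^'d^'d"
  shows "cmod (trace (R A ** R B ** C)) \<le> norm (mat 1 :: complex^'d^'d) * ((\<gamma> TYPE('d))\<^sup>2 * norm C)"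
    and "cmod (trace (R A ** C ** R B ** R D ** E)) \<le> norm (mat 1 :: complex^'d^'d) * ((\<gamma> TYPE('d)) ^ 3 * (norm C * norm E))"
    and "cmod (trace (R A ** R B ** C ** R D ** E)) \<le> norm (mat 1 :: complex^'d^'d) * ((\<gamma> TYPE('d)) ^ 3 * (norm C * norm E))"
proof -
  let ?g = "\<gamma> TYPE('d)"
  have m: "norm (X ** Y) \<le> x * y" if "norm X \<le> x" "norm Y \<le> y" for X Y :: "complex^'d^'d" and x y
    using order_trans[OF norm_matrix_mult mult_mono, OF that] that
    by (meson norm_ge_zero order_trans)
  have "norm (R A ** R B ** C) \<le> ?g * ?g * norm C" by (intro m norm_R order_refl)
  thus "cmod (trace (R A ** R B ** C)) \<le> norm (mat 1 :: complex^'d^'d) * (?g\<^sup>2 * norm C)"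
    unfolding power2_eq_square by (rule order_trans[OF norm_trace mult_left_mono]) simp
  have "norm (R A ** C ** R B ** R D ** E) \<le> ?g * norm C * ?g * ?g * norm E" by (intro m norm_R order_refl)
  also have "\<dots> = ?g ^ 3 * (norm C * norm E)" by (simp add: power3_eq_cube)
  finally show "cmod (trace (R A ** C ** R B ** R D ** E)) \<le> norm (mat 1 :: complex^'d^'d) * (?g ^ 3 * (norm C * norm E))"
    by (intro order_trans[OF norm_trace mult_left_mono]) simp_all
  have "norm (R A ** R B ** C ** R D ** E) \<le> ?g * ?g * norm C * ?g * norm E" by (intro m norm_R order_refl)
  also have "\<dots> = ?g ^ 3 * (norm C * norm E)" by (simp add: power3_eq_cube)
  finally show "cmod (trace (R A ** R B ** C ** R D ** E)) \<le> norm (mat 1 :: complex^'d^'d) * (?g ^ 3 * (norm C * norm E))"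
    by (intro order_trans[OF norm_trace mult_left_mono]) simp_all
qed

end

text \<open>Gaussianity is phrased through all real functionals rather than through entries: this is
  the form in which the characteristic function is computed, and it is free of coordinates.\<close>

locale centered_gaussian = prob_space N for N :: "'b measure" +
  fixes G :: "'b \<Rightarrow> complex^'d^'d"
  assumes gaussian: "gaussian_rv N (\<lambda>\<omega>. a \<bullet> G \<omega>)"
    and mean_zero: "(\<integral>\<omega>. G \<omega> \<partial>N) = 0"
    and G_self_adjoint: "\<omega> \<in> space N \<Longrightarrow> self_adjoint (G \<omega>)"
begin

lemma measurable_G [measurable]: "G \<in> borel_measurable N"
proof (rule borel_measurable_euclidean_space[THEN iffD2], intro ballI)
  fix b :: "complex^'d^'d"
  show "(\<lambda>\<omega>. G \<omega> \<bullet> b) \<in> borel_measurable N"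
    using gaussian[of b] by (simp add: gaussian_rv_def inner_commute)
qed

lemma integrable_norm_sq: "integrable N (\<lambda>\<omega>. (norm (G \<omega>))\<^sup>2)"
proof -
  have "(norm (G \<omega>))\<^sup>2 = (\<Sum>b\<in>Basis. (b \<bullet> G \<omega>)\<^sup>2)" for \<omega>
    unfolding power2_norm_eq_inner by (subst euclidean_inner) (simp add: power2_eq_square inner_commute)
  thus ?thesis
    by (simp add: gaussian_rv_integrable_square[OF prob_space_axioms gaussian])
qed

lemma integrable_G: "integrable N G"
  by (rule integrable_of_norm_square[OF measurable_G integrable_norm_sq])

lemma integrable_norm: "integrable N (\<lambda>\<omega>. norm (G \<omega>))"
  using integrable_G by (rule Bochner_Integration.integrable_norm)

lemma char_G: "(\<integral>\<omega>. iexp (a \<bullet> G \<omega>) \<partial>N) = of_real (exp (- (\<integral>\<omega>. (a \<bullet> G \<omega>)\<^sup>2 \<partial>N) / 2))"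
proof (rule gaussian_rv_char[OF prob_space_axioms gaussian])
  show "(\<integral>\<omega>. a \<bullet> G \<omega> \<partial>N) = 0"
    using integral_inner_right[OF integrable_G, of a] mean_zero by simp
qed

sublocale pair: pair_prob_space N N ..

text \<open>A rotation by the angle t of two independent copies of \<open>G\<close>. The second
  component is the derivative of the first with respect to t.\<close>

definition rot :: "real \<Rightarrow> 'b \<times> 'b \<Rightarrow> (complex^'d^'d) \<times> (complex^'d^'d)" where
  "rot t p = (cos t *\<^sub>R G (fst p) + sin t *\<^sub>R G (snd p), cos t *\<^sub>R G (snd p) - sin t *\<^sub>R G (fst p))"

lemma measurable_rot [measurable]: "rot t \<in> borel_measurable (N \<Otimes>\<^sub>M N)"
  unfolding rot_def borel_prod[symmetric] by measurable

lemma measurable_fst_snd_rot [measurable]: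
  "(\<lambda>p. fst (rot t p)) \<in> borel_measurable (N \<Otimes>\<^sub>M N)"
  "(\<lambda>p. snd (rot t p)) \<in> borel_measurable (N \<Otimes>\<^sub>M N)"
  unfolding rot_def fst_conv snd_conv by measurable

text \<open>The rotation is moved onto the frequencies (a, b), independence factorizes the integral,
  and the sum of the two second moments is rotation invariant. The right-hand side is therefore free
  of t.\<close>

lemma rot_char:
  "(\<integral>p. iexp ((a, b) \<bullet> rot t p) \<partial>(N \<Otimes>\<^sub>M N))
    = of_real (exp (- (\<integral>\<omega>. (a \<bullet> G \<omega>)\<^sup>2 + (b \<bullet> G \<omega>)\<^sup>2 \<partial>N) / 2))"
proof -
  define \<alpha> where "\<alpha> = cos t *\<^sub>R a - sin t *\<^sub>R b"
  define \<beta> where "\<beta> = sin t *\<^sub>R a + cos t *\<^sub>R b"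
  have e: "iexp ((a, b) \<bullet> rot t p) = iexp (\<alpha> \<bullet> G (fst p)) * iexp (\<beta> \<bullet> G (snd p))" for p
    unfolding exp_add[symmetric]
    by (simp add: rot_def \<alpha>_def \<beta>_def inner_add_left inner_add_right inner_diff_left inner_diff_right algebra_simps)
  have i: "integrable N (\<lambda>\<omega>. iexp (a \<bullet> G \<omega>))" for a
    by (rule integrable_iexp) simp_all
  have sq: "integrable N (\<lambda>\<omega>. (a \<bullet> G \<omega>)\<^sup>2)" for a
    by (rule gaussian_rv_integrable_square[OF prob_space_axioms gaussian])
  \<comment> \<open>The cross terms cancel pointwise, before any integration, so no covariance
    between the two functionals enters.\<close>
  have "(d * A - s * B)\<^sup>2 + (s * A + d * B)\<^sup>2 = (s\<^sup>2 + d\<^sup>2) * (A\<^sup>2 + B\<^sup>2)" for s d A B :: real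
    by (simp add: power2_eq_square algebra_simps)
  hence "(\<alpha> \<bullet> X)\<^sup>2 + (\<beta> \<bullet> X)\<^sup>2 = ((sin t)\<^sup>2 + (cos t)\<^sup>2) * ((a \<bullet> X)\<^sup>2 + (b \<bullet> X)\<^sup>2)" for X
    by (simp only: \<alpha>_def \<beta>_def inner_add_left inner_diff_left inner_scaleR_left)
  hence "(\<integral>\<omega>. (a \<bullet> G \<omega>)\<^sup>2 + (b \<bullet> G \<omega>)\<^sup>2 \<partial>N) = (\<integral>\<omega>. (\<alpha> \<bullet> G \<omega>)\<^sup>2 + (\<beta> \<bullet> G \<omega>)\<^sup>2 \<partial>N)"
    by simp
  also have "\<dots> = (\<integral>\<omega>. (\<alpha> \<bullet> G \<omega>)\<^sup>2 \<partial>N) + (\<integral>\<omega>. (\<beta> \<bullet> G \<omega>)\<^sup>2 \<partial>N)"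
    by (intro Bochner_Integration.integral_add sq)
  finally have sum: "(\<integral>\<omega>. (a \<bullet> G \<omega>)\<^sup>2 + (b \<bullet> G \<omega>)\<^sup>2 \<partial>N)
    = (\<integral>\<omega>. (\<alpha> \<bullet> G \<omega>)\<^sup>2 \<partial>N) + (\<integral>\<omega>. (\<beta> \<bullet> G \<omega>)\<^sup>2 \<partial>N)" .
  have "(\<integral>p. iexp ((a, b) \<bullet> rot t p) \<partial>(N \<Otimes>\<^sub>M N)) = (\<integral>\<omega>. iexp (\<alpha> \<bullet> G \<omega>) \<partial>N) * (\<integral>\<omega>. iexp (\<beta> \<bullet> G \<omega>) \<partial>N)"
    unfolding e by (rule pair.integral_mult_pair[OF i i])
  also have "\<dots> = of_real (exp (- ((\<integral>\<omega>. (\<alpha> \<bullet> G \<omega>)\<^sup>2 \<partial>N) + (\<integral>\<omega>. (\<beta> \<bullet> G \<omega>)\<^sup>2 \<partial>N)) / 2))"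
    unfolding char_G of_real_mult[symmetric] exp_add[symmetric] by (simp add: diff_divide_distrib)
  finally show ?thesis unfolding sum .
qed

lemma rot_distr: "distr (N \<Otimes>\<^sub>M N) borel (rot t) = distr (N \<Otimes>\<^sub>M N) borel (rot 0)"
proof (rule char_uniqueness_euclidean)
  show "prob_space (distr (N \<Otimes>\<^sub>M N) borel (rot t))" "prob_space (distr (N \<Otimes>\<^sub>M N) borel (rot 0))"
    by (rule pair.prob_space_distr, simp)+
  fix u :: "(complex^'d^'d) \<times> (complex^'d^'d)"
  obtain a b where u: "u = (a, b)" by (cases u)
  have "(\<integral>x. iexp (u \<bullet> x) \<partial>distr (N \<Otimes>\<^sub>M N) borel (rot t)) = (\<integral>p. iexp (u \<bullet> rot t p) \<partial>(N \<Otimes>\<^sub>M N))" for t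
    by (rule integral_distr) simp_all
  thus "(\<integral>x. iexp (u \<bullet> x) \<partial>distr (N \<Otimes>\<^sub>M N) borel (rot t)) = (\<integral>x. iexp (u \<bullet> x) \<partial>distr (N \<Otimes>\<^sub>M N) borel (rot 0))"
    unfolding u by (simp only: rot_char)
qed simp_all

end

locale gaussian_resolvent = centered_gaussian N G + resolvent \<zeta>
  for N :: "'b measure" and G :: "'b \<Rightarrow> complex^'d^'d" and \<zeta> :: complex
begin

text \<open>Gaussian integration by parts without coordinates: the pair of \<open>G\<close> and an independent copy is
  rotation invariant, so the integral of \<open>trace (R\<^sup>2 B)\<close> at the rotated pair is constant, and its
  derivative at angle \<open>0\<close> vanishes.\<close>

lemma gaussian_integration_by_parts:
  fixes x :: "complex^'d^'d" and c :: real
  assumes x: "self_adjoint x"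
  defines "Y \<equiv> \<lambda>\<omega>. x + c *\<^sub>R G \<omega>"
  shows "(\<integral>\<omega>. trace (R (Y \<omega>) ** R (Y \<omega>) ** G \<omega>) \<partial>N)
    = 2 * c * (\<integral>\<omega>. (\<integral>\<omega>'. trace (R (Y \<omega>) ** R (Y \<omega>) ** G \<omega>' ** R (Y \<omega>) ** G \<omega>') \<partial>N) \<partial>N)"
proof -
  let ?Q = "N \<Otimes>\<^sub>M N"
  let ?g = "\<gamma> TYPE('d)" and ?D = "norm (mat 1 :: complex^'d^'d)"
  define \<Phi> where "\<Phi> p = trace (R (x + c *\<^sub>R fst p) ** R (x + c *\<^sub>R fst p) ** snd p)"
    for p :: "(complex^'d^'d) \<times> (complex^'d^'d)"
  have [measurable]: "\<Phi> \<in> borel_measurable borel"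
    unfolding \<Phi>_def borel_prod[symmetric] by measurable
  \<comment> \<open>A majorant of both rotated components that is uniform in the angle, since |sin|
    and |cos| are at most 1; it controls the differentiation under the integral.\<close>
  define n where "n p = norm (G (fst p)) + norm (G (snd p))" for p
  have n0: "0 \<le> n p" for p by (simp add: n_def)
  have nm[measurable]: "n \<in> borel_measurable ?Q" unfolding n_def by measurable
  have n_int: "integrable ?Q n"
    unfolding n_def by (intro Bochner_Integration.integrable_add pair.integrable_fst_snd integrable_norm)
  have n2_int: "integrable ?Q (\<lambda>p. (n p)\<^sup>2)"
  proof (rule Bochner_Integration.integrable_bound)
    show "integrable ?Q (\<lambda>p. 2 * (norm (G (fst p)))\<^sup>2 + 2 * (norm (G (snd p)))\<^sup>2)"
      by (intro Bochner_Integration.integrable_add integrable_mult_right pair.integrable_fst_snd integrable_norm_sq)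
    have "(n p)\<^sup>2 \<le> 2 * (norm (G (fst p)))\<^sup>2 + 2 * (norm (G (snd p)))\<^sup>2" for p
      using sum_squares_bound[of "norm (G (fst p))" "norm (G (snd p))"]
      by (simp add: n_def power2_sum)
    thus "AE p in ?Q. norm ((n p)\<^sup>2) \<le> norm (2 * (norm (G (fst p)))\<^sup>2 + 2 * (norm (G (snd p)))\<^sup>2)"
      by (intro AE_I2) simp
  qed simp
  have rot_n: "norm (fst (rot t p)) \<le> n p" "norm (snd (rot t p)) \<le> n p" for t p
  proof -
    have *: "norm (cos t *\<^sub>R A) \<le> norm A" "norm (sin t *\<^sub>R A) \<le> norm A" for A :: "complex^'d^'d"
      by (simp_all add: mult_left_le_one_le)
    show "norm (fst (rot t p)) \<le> n p"
      unfolding rot_def n_def fst_conv by (intro norm_triangle_le add_mono *)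
    show "norm (snd (rot t p)) \<le> n p"
      unfolding rot_def n_def snd_conv add.commute[of "norm (G (fst p))"]
      by (intro norm_triangle_le_diff add_mono *)
  qed
  have rot_sa: "self_adjoint (fst (rot t p))" if "p \<in> space ?Q" for t p
    using that by (auto simp: rot_def space_pair_measure intro!: self_adjoint_add self_adjoint_scaleR G_self_adjoint)
  define r where "r t p = R (x + c *\<^sub>R fst (rot t p))" for t p
  define f where "f t p = \<Phi> (rot t p)" for t p
  \<comment> \<open>The derivative of \<open>f\<close>: one term for each of the two resolvents,
    with inner derivative \<open>c\<close> times the second component, and a last one because the
    second component has derivative minus the first.\<close>
  define f' where "f' t p = c * (trace (r t p ** snd (rot t p) ** r t p ** r t p ** snd (rot t p))
      + trace (r t p ** r t p ** snd (rot t p) ** r t p ** snd (rot t p)))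
      - trace (r t p ** r t p ** fst (rot t p))" for t p
  have [measurable]: "r t \<in> borel_measurable ?Q" for t unfolding r_def by measurable
  have [measurable]: "f t \<in> borel_measurable ?Q" for t unfolding f_def by measurable
  have [measurable]: "f' t \<in> borel_measurable ?Q" for t unfolding f'_def by measurable
  have D: "((\<lambda>t. \<integral>p. f t p \<partial>?Q) has_vector_derivative (\<integral>p. f' 0 p \<partial>?Q)) (at 0)"
  proof (rule has_vector_derivative_integral)
    show "integrable ?Q (f t)" for t
    proof (rule Bochner_Integration.integrable_bound)
      show "integrable ?Q (\<lambda>p. ?D * (?g\<^sup>2 * n p))" by (intro integrable_mult_right n_int)
      show "AE p in ?Q. norm (f t p) \<le> norm (?D * (?g\<^sup>2 * n p))"
        unfolding f_def \<Phi>_def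
        by (intro AE_I2 order_trans[OF trace_R_products_bound(1)])
           (auto simp: abs_mult n0 intro!: mult_left_mono rot_n)
    qed simp
    show "f' 0 \<in> borel_measurable ?Q" by simp
    show "integrable ?Q (\<lambda>p. \<bar>c\<bar> * (2 * (?D * (?g ^ 3 * (n p)\<^sup>2))) + ?D * (?g\<^sup>2 * n p))"
      by (intro Bochner_Integration.integrable_add integrable_mult_right n_int n2_int)
    fix t p assume p: "p \<in> space ?Q"
    show "((\<lambda>t. f t p) has_vector_derivative f' t p) (at t)"
    proof -
      have d1: "((\<lambda>u. fst (rot u p)) has_vector_derivative snd (rot u p)) (at u)" for u
        unfolding rot_def fst_conv snd_conv
        by (auto intro!: derivative_eq_intros simp: algebra_simps)
      have d2: "((\<lambda>u. snd (rot u p)) has_vector_derivative - fst (rot u p)) (at u)" for u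
        unfolding rot_def fst_conv snd_conv
        by (auto intro!: derivative_eq_intros simp: algebra_simps)
      have "((\<lambda>u. x + c *\<^sub>R fst (rot u p)) has_vector_derivative c *\<^sub>R snd (rot t p)) (at t)"
        by (auto intro!: derivative_eq_intros d1)
      hence dr: "((\<lambda>u. r u p) has_vector_derivative r t p ** (c *\<^sub>R snd (rot t p)) ** r t p) (at t)"
        unfolding r_def
        by (rule R_has_vector_derivative) (intro self_adjoint_add self_adjoint_scaleR x rot_sa p)
      have D: "((\<lambda>u. trace (r u p ** r u p ** snd (rot u p))) has_vector_derivative
          trace (r t p ** r t p ** (- fst (rot t p)) +
           (r t p ** (r t p ** (c *\<^sub>R snd (rot t p)) ** r t p) + (r t p ** (c *\<^sub>R snd (rot t p)) ** r t p) ** r t p) ** snd (rot t p))) (at t)"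
        by (intro bounded_linear.has_vector_derivative[OF bounded_linear_trace] matrix_mult.has_vector_derivative dr d2)
      have E: "trace (r t p ** r t p ** (- fst (rot t p)) +
           (r t p ** (r t p ** (c *\<^sub>R snd (rot t p)) ** r t p) + (r t p ** (c *\<^sub>R snd (rot t p)) ** r t p) ** r t p) ** snd (rot t p)) = f' t p"
        unfolding f'_def
        by (simp add: trace_add trace_scaleR matrix_mult_add_left matrix_mult_scaleR_left matrix_mult_scaleR_right
            matrix_mult.minus_right matrix_mul_assoc trace_uminus trace_sub algebra_simps)
      show ?thesis using D unfolding E by (simp add: f_def \<Phi>_def r_def)
    qed
    have "norm (f' t p) \<le> \<bar>c\<bar> * (?D * (?g ^ 3 * (norm (snd (rot t p)) * norm (snd (rot t p))))
        + ?D * (?g ^ 3 * (norm (snd (rot t p)) * norm (snd (rot t p))))) + ?D * (?g\<^sup>2 * norm (fst (rot t p)))"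
      unfolding f'_def r_def
      by (intro norm_triangle_le_diff add_mono order_trans[OF eq_refl[OF norm_mult]]
          mult_mono norm_triangle_le trace_R_products_bound) auto
    also have "\<dots> \<le> \<bar>c\<bar> * (?D * (?g ^ 3 * (n p * n p)) + ?D * (?g ^ 3 * (n p * n p))) + ?D * (?g\<^sup>2 * n p)"
      by (intro add_mono mult_left_mono mult_mono rot_n n0) (auto simp: \<gamma>_nonneg)
    finally show "norm (f' t p) \<le> \<bar>c\<bar> * (2 * (?D * (?g ^ 3 * (n p)\<^sup>2))) + ?D * (?g\<^sup>2 * n p)"
      by (simp add: power2_eq_square mult_ac)
  qed
  \<comment> \<open>Only the law of the rotated pair enters the integral, and that law does not
    depend on the angle.\<close>
  have const: "(\<lambda>t. \<integral>p. f t p \<partial>?Q) = (\<lambda>t. \<integral>p. f 0 p \<partial>?Q)"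
  proof
    fix t
    have "(\<integral>p. f t p \<partial>?Q) = (\<integral>y. \<Phi> y \<partial>distr ?Q borel (rot t))" for t
      unfolding f_def by (rule integral_distr[symmetric]) simp_all
    thus "(\<integral>p. f t p \<partial>?Q) = (\<integral>p. f 0 p \<partial>?Q)" by (simp only: rot_distr[of t])
  qed
  have zero: "(\<integral>p. f' 0 p \<partial>?Q) = 0"
    using D unfolding const
    by (rule vector_derivative_unique_at[OF _ has_vector_derivative_const])
  define h1 where "h1 p = trace (R (Y (fst p)) ** R (Y (fst p)) ** G (snd p) ** R (Y (fst p)) ** G (snd p))" for p
  define h2 where "h2 \<omega> = trace (R (Y \<omega>) ** R (Y \<omega>) ** G \<omega>)" for \<omega>
  have [measurable]: "h1 \<in> borel_measurable ?Q" "h2 \<in> borel_measurable N"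
    unfolding h1_def h2_def Y_def by measurable
  \<comment> \<open>At angle 0 the pair is (G, G'). Cyclicity merges the two resolvent terms into 2
    c \<open>h1\<close>, and \<open>h2\<close> is the left-hand side of the claim.\<close>
  have f'0: "f' 0 p = 2 * c * h1 p - h2 (fst p)" for p
  proof -
    let ?r = "R (Y (fst p))" and ?H = "G (snd p)"
    have "trace (?r ** ?H ** ?r ** ?r ** ?H) = trace (?r ** ?r ** ?H ** ?r ** ?H)"
      using trace_mul_sym[of "?r ** ?H" "?r ** ?r ** ?H"] by (simp add: matrix_mul_assoc)
    thus ?thesis by (simp add: f'_def r_def rot_def h1_def h2_def Y_def)
  qed
  have h1_int: "integrable ?Q h1"
  proof (rule Bochner_Integration.integrable_bound)
    show "integrable ?Q (\<lambda>p. ?D * (?g ^ 3 * (norm (G (snd p)))\<^sup>2))"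
      by (intro integrable_mult_right pair.integrable_fst_snd integrable_norm_sq)
    show "AE p in ?Q. norm (h1 p) \<le> norm (?D * (?g ^ 3 * (norm (G (snd p)))\<^sup>2))"
      unfolding h1_def
      by (intro AE_I2 order_trans[OF trace_R_products_bound(3)]) (simp add: power2_eq_square \<gamma>_nonneg)
  qed simp
  have h2_int: "integrable N h2"
  proof (rule Bochner_Integration.integrable_bound)
    show "integrable N (\<lambda>\<omega>. ?D * (?g\<^sup>2 * norm (G \<omega>)))" by (intro integrable_mult_right integrable_norm)
    show "AE \<omega> in N. norm (h2 \<omega>) \<le> norm (?D * (?g\<^sup>2 * norm (G \<omega>)))"
      unfolding h2_def by (intro AE_I2 order_trans[OF trace_R_products_bound(1)]) simp
  qed simp
  have h2_pair: "integrable ?Q (\<lambda>p. h2 (fst p))" "(\<integral>p. h2 (fst p) \<partial>?Q) = (\<integral>\<omega>. h2 \<omega> \<partial>N)"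
  proof -
    show i: "integrable ?Q (\<lambda>p. h2 (fst p))"
      by (rule pair.Fubini_integrable) (use h2_int in \<open>auto simp: prob_space\<close>)
    show "(\<integral>p. h2 (fst p) \<partial>?Q) = (\<integral>\<omega>. h2 \<omega> \<partial>N)"
      using pair.integral_fst'[OF i] by (simp add: prob_space)
  qed
  have "(\<integral>\<omega>. h2 \<omega> \<partial>N) = 2 * c * (\<integral>p. h1 p \<partial>?Q)"
    using zero unfolding f'0 using h1_int h2_pair by simp
  also have "(\<integral>p. h1 p \<partial>?Q) = (\<integral>\<omega>. (\<integral>\<omega>'. h1 (\<omega>, \<omega>') \<partial>N) \<partial>N)"
    using pair.integral_fst'[OF h1_int] by simp
  finally show ?thesis by (simp add: h1_def h2_def)
qed

end

section \<open>Variance tensors of independent sums\<close>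

lemma norm_kronecker: "norm (kronecker A B) = norm A * norm (B :: complex^'d^'d)"
proof -
  have pair: "(\<Sum>p\<in>(UNIV :: ('d \<times> 'd) set). f p) = (\<Sum>i\<in>UNIV. \<Sum>j\<in>UNIV. f (i, j))" for f :: "'d \<times> 'd \<Rightarrow> real"
    by (simp add: sum.cartesian_product)
  have "(norm (kronecker A B))\<^sup>2 = (\<Sum>p\<in>UNIV. \<Sum>q\<in>UNIV. (cmod (A $ fst p $ fst q))\<^sup>2 * (cmod (B $ snd p $ snd q))\<^sup>2)"
    by (simp add: norm_matrix_sq kronecker_def norm_mult power_mult_distrib)
  also have "\<dots> = (\<Sum>i\<in>UNIV. \<Sum>k\<in>UNIV. \<Sum>j\<in>UNIV. \<Sum>l\<in>UNIV. (cmod (A $ i $ j))\<^sup>2 * (cmod (B $ k $ l))\<^sup>2)"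
    by (simp only: pair fst_conv snd_conv)
  also have "\<dots> = (\<Sum>i\<in>UNIV. \<Sum>k\<in>UNIV. (\<Sum>j\<in>UNIV. (cmod (A $ i $ j))\<^sup>2) * (\<Sum>l\<in>UNIV. (cmod (B $ k $ l))\<^sup>2))"
    by (simp add: sum_product)
  also have "\<dots> = (norm A * norm B)\<^sup>2"
    by (simp add: power_mult_distrib norm_matrix_sq sum_product)
  finally show ?thesis by (simp add: power2_eq_iff_nonneg)
qed

interpretation kronecker: bounded_bilinear "kronecker :: complex^'d^'d \<Rightarrow> complex^'d^'d \<Rightarrow> _"
  by unfold_locales
     (auto simp: norm_kronecker intro!: exI[of _ 1],
      simp_all add: kronecker_def vec_eq_iff algebra_simps)

text \<open>The index pattern makes this, at a Kronecker square of H, the sum of P_ab H_bc Q_ce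
  H_ea. Being linear in the tensor, it shows that expectations of trace (P H Q H) depend on H only
  through the expected Kronecker square.\<close>

definition tensor_trace :: "complex^'d^'d \<Rightarrow> complex^'d^'d \<Rightarrow> complex^('d \<times> 'd)^('d \<times> 'd) \<Rightarrow> complex" where
  "tensor_trace P Q T = (\<Sum>a\<in>UNIV. \<Sum>b\<in>UNIV. \<Sum>c\<in>UNIV. \<Sum>e\<in>UNIV. P $ a $ b * Q $ c $ e * T $ (b, e) $ (c, a))"

lemma bounded_linear_tensor_trace: "bounded_linear (tensor_trace P Q)"
proof -
  have "linear (tensor_trace P Q)"
    by (rule linearI) (simp_all add: tensor_trace_def sum.distrib algebra_simps scaleR_sum_right)
  thus ?thesis by (simp add: linear_conv_bounded_linear)
qed

lemma tensor_trace_kronecker: "tensor_trace P Q (kronecker H H) = trace (P ** H ** Q ** H)"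
proof -
  have "trace (P ** H ** Q ** H) = trace ((P ** H) ** (Q ** H))"
    by (simp add: matrix_mul_assoc)
  also have "\<dots> = (\<Sum>a\<in>UNIV. \<Sum>c\<in>UNIV. \<Sum>b\<in>UNIV. \<Sum>e\<in>UNIV. P $ a $ b * Q $ c $ e * (H $ b $ c * H $ e $ a))"
    unfolding trace_mult_sum by (simp add: matrix_matrix_mult_def sum_product) (simp add: mult_ac)
  also have "\<dots> = tensor_trace P Q (kronecker H H)"
    unfolding tensor_trace_def by (subst (2) sum.swap) (simp add: kronecker_def)
  finally show ?thesis ..
qed

lemma integrable_bilinear_square:
  fixes H :: "'a \<Rightarrow> 'b::{second_countable_topology, real_normed_vector}"
    and B :: "'b \<Rightarrow> 'b \<Rightarrow> 'c::{banach, second_countable_topology}"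
  assumes B: "bounded_bilinear B" and [measurable]: "H \<in> borel_measurable M" "K \<in> borel_measurable M"
    and int: "integrable M (\<lambda>\<omega>. (norm (H \<omega>))\<^sup>2)" "integrable M (\<lambda>\<omega>. (norm (K \<omega>))\<^sup>2)"
  shows "integrable M (\<lambda>\<omega>. B (H \<omega>) (K \<omega>))"
proof -
  obtain c where c: "\<And>x y. norm (B x y) \<le> norm x * norm y * c" "c > 0"
    using bounded_bilinear.pos_bounded[OF B] by blast
  show ?thesis
  proof (rule Bochner_Integration.integrable_bound)
    show "integrable M (\<lambda>\<omega>. ((norm (H \<omega>))\<^sup>2 + (norm (K \<omega>))\<^sup>2) * c)"
      by (intro integrable_mult_left Bochner_Integration.integrable_add int)
    show "(\<lambda>\<omega>. B (H \<omega>) (K \<omega>)) \<in> borel_measurable M"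
      by (rule borel_measurable_continuous_Pair) (auto intro!: bounded_bilinear.continuous_on[OF B] continuous_intros)
    show "AE \<omega> in M. norm (B (H \<omega>) (K \<omega>)) \<le> norm (((norm (H \<omega>))\<^sup>2 + (norm (K \<omega>))\<^sup>2) * c)"
    proof (rule AE_I2)
      fix \<omega>
      have "2 * (norm (H \<omega>) * norm (K \<omega>)) \<le> (norm (H \<omega>))\<^sup>2 + (norm (K \<omega>))\<^sup>2"
        using sum_squares_bound[of "norm (H \<omega>)" "norm (K \<omega>)"] by simp
      hence "norm (H \<omega>) * norm (K \<omega>) \<le> (norm (H \<omega>))\<^sup>2 + (norm (K \<omega>))\<^sup>2"
        using mult_nonneg_nonneg[OF norm_ge_zero[of "H \<omega>"] norm_ge_zero[of "K \<omega>"]] by linarith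
      hence "norm (H \<omega>) * norm (K \<omega>) * c \<le> ((norm (H \<omega>))\<^sup>2 + (norm (K \<omega>))\<^sup>2) * c"
        using c(2) by (intro mult_right_mono) auto
      thus "norm (B (H \<omega>) (K \<omega>)) \<le> norm (((norm (H \<omega>))\<^sup>2 + (norm (K \<omega>))\<^sup>2) * c)"
        using c by (smt (verit) real_norm_def)
    qed
  qed
qed

text \<open>With \<open>V\<close> frozen, the map is linear in \<open>U\<close> and commutes with
  the expectation, which is zero.\<close>

lemma (in prob_space) integral_bilinear_indep:
  fixes U V :: "'a \<Rightarrow> 'b::{second_countable_topology, banach}"
    and B :: "'b \<Rightarrow> 'b \<Rightarrow> 'c::{banach, second_countable_topology}"
  assumes B: "bounded_bilinear B" and indep: "indep_var borel U borel V"
    and int: "integrable M (\<lambda>\<omega>. (norm (U \<omega>))\<^sup>2)" "integrable M (\<lambda>\<omega>. (norm (V \<omega>))\<^sup>2)"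
    and mean: "(\<integral>\<omega>. U \<omega> \<partial>M) = 0"
  shows "(\<integral>\<omega>. B (U \<omega>) (V \<omega>) \<partial>M) = 0"
proof -
  have [measurable]: "U \<in> borel_measurable M" "V \<in> borel_measurable M"
    using indep unfolding indep_var_distribution_eq by auto
  have U: "integrable M U" by (rule integrable_of_norm_square) (use int in auto)
  have [measurable]: "(\<lambda>p. B (fst p) (snd p)) \<in> borel_measurable (borel \<Otimes>\<^sub>M borel)"
    by (rule borel_measurable_continuous_Pair) (auto intro!: bounded_bilinear.continuous_on[OF B] continuous_intros)
  have "(\<integral>\<omega>. B (U \<omega>) (V \<omega>) \<partial>M) = (\<integral>\<omega>. (\<integral>\<omega>'. B (U \<omega>') (V \<omega>) \<partial>M) \<partial>M)"
    using indep_var_integral_prod[OF indep, of "\<lambda>p. B (fst p) (snd p)"] integrable_bilinear_square[OF B _ _ int]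
    by simp
  also have "\<dots> = (\<integral>\<omega>. B (\<integral>\<omega>'. U \<omega>' \<partial>M) (V \<omega>) \<partial>M)"
    using integral_bounded_linear[OF bounded_bilinear.bounded_linear_left[OF B] U] by simp
  finally show ?thesis by (simp add: mean bounded_bilinear.zero_left[OF B])
qed

section \<open>Sums of independent centered self-adjoint matrices\<close>

locale independent_sum = prob_space M for M :: "'a measure" +
  fixes A :: "nat \<Rightarrow> 'a \<Rightarrow> complex^'d^'d" and I :: "nat set"
  assumes finite_I: "finite I"
    and indep: "indep_vars (\<lambda>_. borel) A I"
    and mean_zero: "\<And>i. i \<in> I \<Longrightarrow> (\<integral>\<omega>. A i \<omega> \<partial>M) = 0"
    and integrable_norm_sq: "\<And>i. i \<in> I \<Longrightarrow> integrable M (\<lambda>\<omega>. (norm (A i \<omega>))\<^sup>2)"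
    and A_self_adjoint: "\<And>i \<omega>. i \<in> I \<Longrightarrow> \<omega> \<in> space M \<Longrightarrow> self_adjoint (A i \<omega>)"
begin

lemma measurable_A [measurable]: "i \<in> I \<Longrightarrow> A i \<in> borel_measurable M"
  using indep by (simp add: indep_vars_def)

lemma integrable_A: "i \<in> I \<Longrightarrow> integrable M (A i)"
  by (rule integrable_of_norm_square[OF measurable_A integrable_norm_sq])

definition X :: "'a \<Rightarrow> complex^'d^'d" where "X \<omega> = (\<Sum>i\<in>I. A i \<omega>)"

lemma measurable_X [measurable]: "X \<in> borel_measurable M"
  unfolding X_def by (intro borel_measurable_sum measurable_A)

lemma integrable_X: "integrable M X"
  unfolding X_def by (intro Bochner_Integration.integrable_sum integrable_A)

lemma X_self_adjoint: "\<omega> \<in> space M \<Longrightarrow> self_adjoint (X \<omega>)"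
  unfolding X_def by (intro self_adjoint_sum A_self_adjoint)

lemma indep_var_others:
  assumes "i \<in> I" "J \<subseteq> I - {i}"
  shows "indep_var borel (A i) borel (\<lambda>\<omega>. \<Sum>j\<in>J. A j \<omega>)"
proof (rule indep_var_sum_others)
  show "finite J" using assms finite_I finite_subset by blast
  show "i \<notin> J" using assms by blast
  show "indep_vars (\<lambda>_. borel) A (insert i J)"
    by (rule indep_vars_subset[OF indep]) (use assms in auto)
qed

lemma X_bilinear:
  assumes B: "bounded_bilinear B"
  shows "B (X \<omega>) (X \<omega>) = (\<Sum>i\<in>I. \<Sum>j\<in>I. B (A i \<omega>) (A j \<omega>))"
  unfolding X_def bounded_bilinear.sum_left[OF B]
  by (intro sum.cong refl bounded_bilinear.sum_right[OF B])

lemma integrable_X_bilinear: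
  fixes B :: "complex^'d^'d \<Rightarrow> complex^'d^'d \<Rightarrow> 'c::{banach, second_countable_topology}"
  assumes B: "bounded_bilinear B"
  shows "integrable M (\<lambda>\<omega>. B (X \<omega>) (X \<omega>))"
  unfolding X_bilinear[OF B]
  by (intro Bochner_Integration.integrable_sum integrable_bilinear_square[OF B] measurable_A integrable_norm_sq)

text \<open>Cross terms vanish by independence and centering. Leaving \<open>B\<close> arbitrary
  covers three uses at once: the matrix product for the matrix variance, the Kronecker product for
  the variance tensor and the inner product for the second moment.\<close>

lemma integral_X_bilinear:
  fixes B :: "complex^'d^'d \<Rightarrow> complex^'d^'d \<Rightarrow> 'c::{banach, second_countable_topology}"
  assumes B: "bounded_bilinear B"
  shows "(\<integral>\<omega>. B (X \<omega>) (X \<omega>) \<partial>M) = (\<Sum>i\<in>I. \<integral>\<omega>. B (A i \<omega>) (A i \<omega>) \<partial>M)"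
proof -
  have i: "integrable M (\<lambda>\<omega>. B (A i \<omega>) (A j \<omega>))" if "i \<in> I" "j \<in> I" for i j
    using that by (intro integrable_bilinear_square[OF B] measurable_A integrable_norm_sq)
  have z: "(\<integral>\<omega>. B (A i \<omega>) (A j \<omega>) \<partial>M) = 0" if "i \<in> I" "j \<in> I" "j \<noteq> i" for i j
    using that indep_var_others[of i "{j}"]
    by (intro integral_bilinear_indep[OF B] integrable_norm_sq mean_zero) auto
  have "(\<integral>\<omega>. B (X \<omega>) (X \<omega>) \<partial>M) = (\<Sum>i\<in>I. \<Sum>j\<in>I. \<integral>\<omega>. B (A i \<omega>) (A j \<omega>) \<partial>M)"
    unfolding X_bilinear[OF B]
    using i by simp
  also have "\<dots> = (\<Sum>i\<in>I. \<Sum>j\<in>I. if j = i then \<integral>\<omega>. B (A i \<omega>) (A i \<omega>) \<partial>M else 0)"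
    using z by (intro sum.cong refl) auto
  finally show ?thesis using finite_I by simp
qed

definition total_variance :: real where
  "total_variance = (\<Sum>i\<in>I. \<integral>\<omega>. (norm (A i \<omega>))\<^sup>2 \<partial>M)"

text \<open>For self-adjoint matrices the squared Frobenius norm is the trace of the square. This is
  the bridge from the error bounds to the matrix variance.\<close>

lemma total_variance_eq: "of_real total_variance = trace (\<integral>\<omega>. X \<omega> ** X \<omega> \<partial>M)"
proof -
  have "trace (\<integral>\<omega>. X \<omega> ** X \<omega> \<partial>M) = (\<Sum>i\<in>I. trace (\<integral>\<omega>. A i \<omega> ** A i \<omega> \<partial>M))"
    unfolding integral_X_bilinear[OF matrix_mult.bounded_bilinear_axioms]
    by (rule linear_sum[OF bounded_linear.linear[OF bounded_linear_trace]])
  also have "\<dots> = (\<Sum>i\<in>I. \<integral>\<omega>. trace (A i \<omega> ** A i \<omega>) \<partial>M)"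
    by (intro sum.cong refl integral_bounded_linear[OF bounded_linear_trace, symmetric]
        integrable_bilinear_square[OF matrix_mult.bounded_bilinear_axioms] measurable_A integrable_norm_sq)
  also have "\<dots> = (\<Sum>i\<in>I. \<integral>\<omega>. of_real ((norm (A i \<omega>))\<^sup>2) \<partial>M)"
    by (intro sum.cong refl Bochner_Integration.integral_cong trace_square_self_adjoint A_self_adjoint)
  also have "\<dots> = of_real total_variance"
    by (simp only: total_variance_def of_real_sum integral_complex_of_real)
  finally show ?thesis ..
qed

lemma integral_norm_sq_X: "(\<integral>\<omega>. (norm (X \<omega>))\<^sup>2 \<partial>M) = total_variance"
  using integral_X_bilinear[OF bounded_bilinear_inner] by (simp add: total_variance_def power2_norm_eq_inner)

end

section \<open>Replacing one summand\<close>

lemma norm_integral_le_AE: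
  fixes f :: "'a \<Rightarrow> 'b::{banach, second_countable_topology}"
  assumes "integrable M f" "integrable M g" "AE x in M. norm (f x) \<le> g x"
  shows "norm (\<integral>x. f x \<partial>M) \<le> (\<integral>x. g x \<partial>M)"
  by (rule order_trans[OF integral_norm_bound integral_mono_AE]) (use assms in auto)

locale bounded_sum_resolvent = independent_sum M A I + resolvent \<zeta>
  for M :: "'a measure" and A :: "nat \<Rightarrow> 'a \<Rightarrow> complex^'d^'d" and I and \<zeta> +
  fixes L :: real
  assumes bounded: "\<And>i. i \<in> I \<Longrightarrow> AE \<omega> in M. spectral_norm (A i \<omega>) \<le> L"
begin

text \<open>\<open>P\<close> is deterministic here, so at a random resolvent P = R(Y) the integral
  runs over an independent copy of the summand.\<close>

definition quad_i :: "nat \<Rightarrow> complex^'d^'d \<Rightarrow> complex" where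
  "quad_i i P = (\<integral>\<omega>. trace (P ** P ** A i \<omega> ** P ** A i \<omega>) \<partial>M)"

definition quad :: "complex^'d^'d \<Rightarrow> complex" where "quad P = (\<Sum>i\<in>I. quad_i i P)"

lemma measurable_quad_i [measurable]: "i \<in> I \<Longrightarrow> quad_i i \<in> borel_measurable borel"
  unfolding quad_i_def by measurable

lemma measurable_quad [measurable]: "quad \<in> borel_measurable borel"
  unfolding quad_def by (intro borel_measurable_sum measurable_quad_i)

lemma trace_quad_integrable:
  assumes "i \<in> I"
  shows "integrable M (\<lambda>\<omega>. trace (P ** P ** A i \<omega> ** P ** A i \<omega>))"
proof -
  have "integrable M (\<lambda>\<omega>. tensor_trace (P ** P) P (kronecker (A i \<omega>) (A i \<omega>)))"
    using assms by (intro integrable_bounded_linear[OF bounded_linear_tensor_trace]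
      integrable_bilinear_square[OF kronecker.bounded_bilinear_axioms] measurable_A integrable_norm_sq)
  thus ?thesis by (simp only: tensor_trace_kronecker)
qed

lemma quad_i_tensor:
  assumes "i \<in> I"
  shows "quad_i i P = tensor_trace (P ** P) P (\<integral>\<omega>. kronecker (A i \<omega>) (A i \<omega>) \<partial>M)"
  unfolding quad_i_def tensor_trace_kronecker[symmetric] using assms
  by (intro integral_bounded_linear[OF bounded_linear_tensor_trace]
      integrable_bilinear_square[OF kronecker.bounded_bilinear_axioms] measurable_A integrable_norm_sq)

text \<open>The quadratic term sees the summands only through the variance tensor of their sum; this
  is why matching tensors permits an exchange with the Gaussian.\<close>

lemma quad_tensor: "quad P = tensor_trace (P ** P) P (\<integral>\<omega>. kronecker (X \<omega>) (X \<omega>) \<partial>M)"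
  unfolding integral_X_bilinear[OF kronecker.bounded_bilinear_axioms] quad_def
  by (simp add: quad_i_tensor linear_sum[OF bounded_linear.linear[OF bounded_linear_tensor_trace]])

lemma quad_i_R_bound:
  assumes "i \<in> I"
  shows "cmod (quad_i i (R B)) \<le> norm (mat 1 :: complex^'d^'d) * (\<gamma> TYPE('d) ^ 3 * (\<integral>\<omega>. (norm (A i \<omega>))\<^sup>2 \<partial>M))"
proof -
  have "cmod (quad_i i (R B)) \<le> (\<integral>\<omega>. norm (mat 1 :: complex^'d^'d) * (\<gamma> TYPE('d) ^ 3 * (norm (A i \<omega>))\<^sup>2) \<partial>M)"
    unfolding quad_i_def
    by (intro norm_integral_le_AE trace_quad_integrable assms integrable_mult_right integrable_norm_sq AE_I2
        order_trans[OF trace_R_products_bound(3)]) (simp add: power2_eq_square)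
  thus ?thesis by simp
qed

lemma quad_i_R_integrable:
  assumes i: "i \<in> I" and [measurable]: "V \<in> borel_measurable M"
  shows "integrable M (\<lambda>\<omega>. quad_i i (R (V \<omega>)))"
proof -
  note [measurable] = measurable_quad_i[OF i]
  show ?thesis
    by (rule integrable_const_bound[OF AE_I2[OF quad_i_R_bound[OF i]]]) measurable
qed

lemma quad_R_bound:
  "cmod (quad (R B)) \<le> norm (mat 1 :: complex^'d^'d) * (\<gamma> TYPE('d) ^ 3 * total_variance)"
  unfolding quad_def total_variance_def sum_distrib_left
  by (intro sum_norm_le quad_i_R_bound)

text \<open>Leave-one-out: expanding around the resolvent without the summand \<open>A i\<close>, the first order term
  vanishes by independence and the second order term is \<open>quad_i\<close>.\<close>

lemma leave_one_out:
  assumes i: "i \<in> I" and z: "self_adjoint z" and s: "0 \<le> (s :: real)"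
  defines "Y \<equiv> \<lambda>\<omega>. z + s *\<^sub>R X \<omega>"
  shows "cmod ((\<integral>\<omega>. trace (R (Y \<omega>) ** R (Y \<omega>) ** A i \<omega>) \<partial>M) - 2 * s * (\<integral>\<omega>. quad_i i (R (Y \<omega>)) \<partial>M))
    \<le> 9 * s\<^sup>2 * L * \<beta> ^ 4 * (\<integral>\<omega>. (norm (A i \<omega>))\<^sup>2 \<partial>M)"
proof -
  let ?g = "\<gamma> TYPE('d)" and ?D = "norm (mat 1 :: complex^'d^'d)"
  define v where "v = (\<integral>\<omega>. (norm (A i \<omega>))\<^sup>2 \<partial>M)"
  \<comment> \<open>The interpolating matrix without summand i, hence independent of
    \<open>A i\<close>.\<close>
  define W where "W \<omega> = z + s *\<^sub>R (\<Sum>j\<in>I - {i}. A j \<omega>)" for \<omega>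
  note Ai [measurable] = measurable_A[OF i] and [measurable] = measurable_quad_i[OF i]
  have Ai_int: "integrable M (\<lambda>\<omega>. norm (A i \<omega>))" by (intro integrable_norm integrable_A i)
  have Ai_sq: "integrable M (\<lambda>\<omega>. (norm (A i \<omega>))\<^sup>2)" by (rule integrable_norm_sq[OF i])
  have YW: "Y \<omega> = W \<omega> + s *\<^sub>R A i \<omega>" for \<omega>
    using finite_I i by (simp add: Y_def W_def X_def sum.remove[of I i] scaleR_add_right)
  have Wsa: "self_adjoint (W \<omega>)" if "\<omega> \<in> space M" for \<omega>
    unfolding W_def using that by (intro self_adjoint_add self_adjoint_scaleR self_adjoint_sum z A_self_adjoint) auto
  have indepW: "indep_var borel (A i) borel W"
  proof -
    have "indep_var borel (id \<circ> A i) borel ((\<lambda>v. z + s *\<^sub>R v) \<circ> (\<lambda>\<omega>. \<Sum>j\<in>I - {i}. A j \<omega>))"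
      by (rule indep_var_compose[OF indep_var_others[OF i order_refl]]) auto
    moreover have "(\<lambda>v. z + s *\<^sub>R v) \<circ> (\<lambda>\<omega>. \<Sum>j\<in>I - {i}. A j \<omega>) = W"
      by (auto simp: W_def)
    ultimately show ?thesis by simp
  qed
  have [measurable]: "W \<in> borel_measurable M"
    using indepW unfolding indep_var_distribution_eq by auto
  have [measurable]: "Y \<in> borel_measurable M" unfolding Y_def by measurable
  define f1 f2 f3 where "f1 \<omega> = trace (R (Y \<omega>) ** R (Y \<omega>) ** A i \<omega>)"
    and "f2 \<omega> = trace (R (W \<omega>) ** R (W \<omega>) ** A i \<omega>)"
    and "f3 \<omega> = trace (R (W \<omega>) ** R (W \<omega>) ** A i \<omega> ** R (W \<omega>) ** A i \<omega>)" for \<omega>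
  have [measurable]: "f1 \<in> borel_measurable M" "f2 \<in> borel_measurable M" "f3 \<in> borel_measurable M"
    unfolding f1_def f2_def f3_def by measurable
  have bnd1: "cmod (trace (R B ** R B ** A i \<omega>)) \<le> norm (?D * (?g\<^sup>2 * norm (A i \<omega>)))" for B \<omega>
    by (rule order_trans[OF trace_R_products_bound(1)]) simp
  have int1: "integrable M f1" and int2: "integrable M f2"
  proof -
    have g: "integrable M (\<lambda>\<omega>. ?D * (?g\<^sup>2 * norm (A i \<omega>)))" by (intro integrable_mult_right Ai_int)
    show "integrable M f1"
      by (rule Bochner_Integration.integrable_bound[OF g], simp) (unfold f1_def, intro AE_I2 bnd1)
    show "integrable M f2"
      by (rule Bochner_Integration.integrable_bound[OF g], simp) (unfold f2_def, intro AE_I2 bnd1)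
  qed
  have int3: "integrable M f3"
  proof (rule Bochner_Integration.integrable_bound)
    show "integrable M (\<lambda>\<omega>. ?D * (?g ^ 3 * (norm (A i \<omega>))\<^sup>2))" by (intro integrable_mult_right Ai_sq)
    show "AE \<omega> in M. norm (f3 \<omega>) \<le> norm (?D * (?g ^ 3 * (norm (A i \<omega>))\<^sup>2))"
      unfolding f3_def by (intro AE_I2 order_trans[OF trace_R_products_bound(3)]) (simp add: power2_eq_square \<gamma>_nonneg)
  qed simp
  have a: "cmod ((\<integral>\<omega>. f1 \<omega> \<partial>M) - (\<integral>\<omega>. f2 \<omega> \<partial>M) - 2 * s * (\<integral>\<omega>. f3 \<omega> \<partial>M)) \<le> 3 * s\<^sup>2 * L * \<beta> ^ 4 * v"
  proof -
    have "cmod (\<integral>\<omega>. f1 \<omega> - f2 \<omega> - 2 * s * f3 \<omega> \<partial>M) \<le> (\<integral>\<omega>. 3 * s\<^sup>2 * L * \<beta> ^ 4 * (norm (A i \<omega>))\<^sup>2 \<partial>M)"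
    proof (rule norm_integral_le_AE)
      show "AE \<omega> in M. cmod (f1 \<omega> - f2 \<omega> - 2 * s * f3 \<omega>) \<le> 3 * s\<^sup>2 * L * \<beta> ^ 4 * (norm (A i \<omega>))\<^sup>2"
        using bounded[OF i] AE_space
      proof eventually_elim
        case (elim \<omega>)
        thus ?case
          unfolding f1_def f2_def f3_def YW
          by (intro trace_resolvent_expansion A_self_adjoint i Wsa)
      qed
    qed (intro Bochner_Integration.integrable_diff integrable_mult_right int1 int2 int3 Ai_sq)+
    thus ?thesis using int1 int2 int3 by (simp add: v_def)
  qed
  have b: "(\<integral>\<omega>. f2 \<omega> \<partial>M) = 0"
  proof -
    define \<phi> where "\<phi> p = trace (R (snd p) ** R (snd p) ** fst p)" for p :: "(complex^'d^'d) \<times> (complex^'d^'d)"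
    have [measurable]: "\<phi> \<in> borel_measurable (borel \<Otimes>\<^sub>M borel)" unfolding \<phi>_def by measurable
    have "(\<integral>\<omega>. f2 \<omega> \<partial>M) = (\<integral>\<omega>. (\<integral>\<omega>'. \<phi> (A i \<omega>', W \<omega>) \<partial>M) \<partial>M)"
      using indep_var_integral_prod[OF indepW, of \<phi>] int2[unfolded f2_def] by (simp add: \<phi>_def f2_def)
    also have "\<dots> = (\<integral>\<omega>. 0 \<partial>M)"
    proof (rule Bochner_Integration.integral_cong[OF refl])
      fix \<omega>
      have "bounded_linear (\<lambda>B. trace (R (W \<omega>) ** R (W \<omega>) ** B))"
        by (rule bounded_linear_compose[OF bounded_linear_trace matrix_mult.bounded_linear_right])
      from integral_bounded_linear[OF this integrable_A[OF i]]
      show "(\<integral>\<omega>'. \<phi> (A i \<omega>', W \<omega>) \<partial>M) = 0"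
        by (simp add: \<phi>_def mean_zero[OF i] matrix_mult.zero_right linear_0[OF bounded_linear.linear[OF bounded_linear_trace]])
    qed
    finally show ?thesis by simp
  qed
  \<comment> \<open>Integrating out \<open>A i\<close> with \<open>W\<close> frozen turns the two
    equal factors into a common independent copy.\<close>
  have c: "(\<integral>\<omega>. f3 \<omega> \<partial>M) = (\<integral>\<omega>. quad_i i (R (W \<omega>)) \<partial>M)"
  proof -
    define \<phi> where "\<phi> p = trace (R (snd p) ** R (snd p) ** fst p ** R (snd p) ** fst p)" for p :: "(complex^'d^'d) \<times> (complex^'d^'d)"
    have [measurable]: "\<phi> \<in> borel_measurable (borel \<Otimes>\<^sub>M borel)" unfolding \<phi>_def by measurable
    have "(\<integral>\<omega>. f3 \<omega> \<partial>M) = (\<integral>\<omega>. (\<integral>\<omega>'. \<phi> (A i \<omega>', W \<omega>) \<partial>M) \<partial>M)"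
      using indep_var_integral_prod[OF indepW, of \<phi>] int3[unfolded f3_def] by (simp add: \<phi>_def f3_def)
    thus ?thesis by (simp add: \<phi>_def quad_i_def)
  qed
  note q_int = quad_i_R_integrable[OF i]
  \<comment> \<open>Two different samples of summand i occur: the one at \<omega> moves
    \<open>W\<close> to \<open>Y\<close> and is bounded by \<open>L\<close>, the one at \<omega>'
    belongs to \<open>quad_i\<close> and contributes the second moment.\<close>
  have d: "cmod ((\<integral>\<omega>. quad_i i (R (Y \<omega>)) \<partial>M) - (\<integral>\<omega>. quad_i i (R (W \<omega>)) \<partial>M)) \<le> 3 * s * L * \<beta> ^ 4 * v"
  proof -
    have "cmod (\<integral>\<omega>. quad_i i (R (Y \<omega>)) - quad_i i (R (W \<omega>)) \<partial>M) \<le> (\<integral>\<omega>. 3 * s * L * \<beta> ^ 4 * v \<partial>M)"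
    proof (rule norm_integral_le_AE)
      show "AE \<omega> in M. cmod (quad_i i (R (Y \<omega>)) - quad_i i (R (W \<omega>))) \<le> 3 * s * L * \<beta> ^ 4 * v"
        using bounded[OF i] AE_space
      proof eventually_elim
        case (elim \<omega>)
        have "quad_i i (R (Y \<omega>)) - quad_i i (R (W \<omega>)) = (\<integral>\<omega>'. trace (R (Y \<omega>) ** R (Y \<omega>) ** A i \<omega>' ** R (Y \<omega>) ** A i \<omega>')
            - trace (R (W \<omega>) ** R (W \<omega>) ** A i \<omega>' ** R (W \<omega>) ** A i \<omega>') \<partial>M)"
          unfolding quad_i_def by (intro Bochner_Integration.integral_diff[symmetric] trace_quad_integrable i)
        also have "cmod \<dots> \<le> (\<integral>\<omega>'. 3 * s * L * \<beta> ^ 4 * (norm (A i \<omega>'))\<^sup>2 \<partial>M)"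
        proof (rule norm_integral_le_AE)
          show "AE \<omega>' in M. cmod (trace (R (Y \<omega>) ** R (Y \<omega>) ** A i \<omega>' ** R (Y \<omega>) ** A i \<omega>')
            - trace (R (W \<omega>) ** R (W \<omega>) ** A i \<omega>' ** R (W \<omega>) ** A i \<omega>')) \<le> 3 * s * L * \<beta> ^ 4 * (norm (A i \<omega>'))\<^sup>2"
            unfolding YW using elim by (intro AE_I2 trace_resolvent_quadratic_diff A_self_adjoint i Wsa s)
        qed (intro Bochner_Integration.integrable_diff integrable_mult_right trace_quad_integrable i Ai_sq)+
        finally show ?case by (simp add: v_def)
      qed
    qed (auto intro!: Bochner_Integration.integrable_diff q_int)
    thus ?thesis using q_int by (simp add: prob_space)
  qed
  have e: "cmod (2 * s * ((\<integral>\<omega>. quad_i i (R (Y \<omega>)) \<partial>M) - (\<integral>\<omega>. quad_i i (R (W \<omega>)) \<partial>M)))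
      \<le> (2 * s) * (3 * s * L * \<beta> ^ 4 * v)"
    unfolding norm_mult norm_of_real using s by (intro mult_mono[OF _ d]) auto
  have "(\<integral>\<omega>. f1 \<omega> \<partial>M) - 2 * s * (\<integral>\<omega>. quad_i i (R (Y \<omega>)) \<partial>M)
     = ((\<integral>\<omega>. f1 \<omega> \<partial>M) - (\<integral>\<omega>. f2 \<omega> \<partial>M) - 2 * s * (\<integral>\<omega>. f3 \<omega> \<partial>M))
       - 2 * s * ((\<integral>\<omega>. quad_i i (R (Y \<omega>)) \<partial>M) - (\<integral>\<omega>. quad_i i (R (W \<omega>)) \<partial>M))"
    by (simp add: b c algebra_simps)
  also have "cmod \<dots> \<le> 3 * s\<^sup>2 * L * \<beta> ^ 4 * v + (2 * s) * (3 * s * L * \<beta> ^ 4 * v)"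
    by (rule norm_triangle_le_diff[OF add_mono[OF a e]])
  \<comment> \<open>The 9 is 3 from the expansion plus 2 s times 3 s from replacing \<open>W\<close>
    by \<open>Y\<close> in the quadratic term.\<close>
  also have "\<dots> = 9 * s\<^sup>2 * L * \<beta> ^ 4 * v"
    by (simp add: power2_eq_square algebra_simps)
  finally show ?thesis by (simp add: f1_def v_def)
qed

lemma sum_step:
  assumes z: "self_adjoint z" and s: "0 \<le> (s :: real)"
  defines "Y \<equiv> \<lambda>\<omega>. z + s *\<^sub>R X \<omega>"
  shows "cmod ((\<integral>\<omega>. trace (R (Y \<omega>) ** R (Y \<omega>) ** X \<omega>) \<partial>M) - 2 * s * (\<integral>\<omega>. quad (R (Y \<omega>)) \<partial>M))
    \<le> 9 * s\<^sup>2 * L * \<beta> ^ 4 * total_variance"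
proof -
  have [measurable]: "Y \<in> borel_measurable M" unfolding Y_def by measurable
  have int1: "integrable M (\<lambda>\<omega>. trace (R (Y \<omega>) ** R (Y \<omega>) ** A i \<omega>))" if i: "i \<in> I" for i
  proof (rule Bochner_Integration.integrable_bound)
    show "integrable M (\<lambda>\<omega>. norm (mat 1 :: complex^'d^'d) * ((\<gamma> TYPE('d))\<^sup>2 * norm (A i \<omega>)))"
      by (intro integrable_mult_right integrable_norm integrable_A i)
    show "AE \<omega> in M. norm (trace (R (Y \<omega>) ** R (Y \<omega>) ** A i \<omega>)) \<le> norm (norm (mat 1 :: complex^'d^'d) * ((\<gamma> TYPE('d))\<^sup>2 * norm (A i \<omega>)))"
      by (intro AE_I2 order_trans[OF trace_R_products_bound(1)]) simp
  qed (use measurable_A[OF i] in measurable)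
  have int2: "integrable M (\<lambda>\<omega>. quad_i i (R (Y \<omega>)))" if "i \<in> I" for i
    by (intro quad_i_R_integrable that) simp
  have "trace (R (Y \<omega>) ** R (Y \<omega>) ** X \<omega>) = (\<Sum>i\<in>I. trace (R (Y \<omega>) ** R (Y \<omega>) ** A i \<omega>))" for \<omega>
    by (simp add: X_def matrix_mult.sum_right linear_sum[OF bounded_linear.linear[OF bounded_linear_trace]])
  hence "(\<integral>\<omega>. trace (R (Y \<omega>) ** R (Y \<omega>) ** X \<omega>) \<partial>M) - 2 * s * (\<integral>\<omega>. quad (R (Y \<omega>)) \<partial>M)
    = (\<Sum>i\<in>I. (\<integral>\<omega>. trace (R (Y \<omega>) ** R (Y \<omega>) ** A i \<omega>) \<partial>M) - 2 * s * (\<integral>\<omega>. quad_i i (R (Y \<omega>)) \<partial>M))"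
    using int1 int2 by (simp add: quad_def sum_subtractf sum_distrib_left)
  also have "cmod \<dots> \<le> (\<Sum>i\<in>I. 9 * s\<^sup>2 * L * \<beta> ^ 4 * (\<integral>\<omega>. (norm (A i \<omega>))\<^sup>2 \<partial>M))"
    by (intro sum_norm_le) (use leave_one_out[OF _ z s] in \<open>simp add: Y_def\<close>)
  finally show ?thesis by (simp add: total_variance_def sum_distrib_left)
qed

end

section \<open>Interpolation\<close>

text \<open>Sum and Gaussian keep their own probability spaces; the product measure supplies the
  joint space, and \<open>m\<close> is the common mean.\<close>

locale gaussian_comparison = sum: bounded_sum_resolvent M A I \<zeta> L + gauss: gaussian_resolvent N G \<zeta>
  for M :: "'a measure" and A :: "nat \<Rightarrow> 'a \<Rightarrow> complex^'d^'d" and I and \<zeta> and L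
    and N :: "'b measure" and G :: "'b \<Rightarrow> complex^'d^'d" +
  fixes m :: "complex^'d^'d"
  assumes m: "self_adjoint m"
    and tensors: "(\<integral>\<omega>. kronecker (G \<omega>) (G \<omega>) \<partial>N) = (\<integral>\<omega>. kronecker (sum.X \<omega>) (sum.X \<omega>) \<partial>M)"
begin

abbreviation "R \<equiv> sum.R"
abbreviation "X \<equiv> sum.X"

sublocale pair: pair_prob_space M N ..

text \<open>Equality of the tensors enters the comparison here: the quadratic term of the sum equals
  the one produced by Gaussian integration by parts.\<close>

lemma quad_gaussian: "sum.quad P = (\<integral>\<omega>. trace (P ** P ** G \<omega> ** P ** G \<omega>) \<partial>N)"
  unfolding sum.quad_tensor tensors[symmetric] tensor_trace_kronecker[symmetric]
  by (intro integral_bounded_linear[OF bounded_linear_tensor_trace, symmetric]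
      integrable_bilinear_square[OF kronecker.bounded_bilinear_axioms] gauss.measurable_G gauss.integrable_norm_sq)

definition Y :: "real \<Rightarrow> 'a \<times> 'b \<Rightarrow> complex^'d^'d" where
  "Y t p = m + sin t *\<^sub>R X (fst p) + cos t *\<^sub>R G (snd p)"

definition F :: "real \<Rightarrow> complex" where "F t = (\<integral>p. trace (R (Y t p)) \<partial>(M \<Otimes>\<^sub>M N))"

definition F' :: "real \<Rightarrow> complex" where
  "F' t = (\<integral>p. trace (R (Y t p) ** R (Y t p) ** (cos t *\<^sub>R X (fst p) - sin t *\<^sub>R G (snd p))) \<partial>(M \<Otimes>\<^sub>M N))"

lemma measurable_Y [measurable]: "Y t \<in> borel_measurable (M \<Otimes>\<^sub>M N)"
  unfolding Y_def by measurable

lemma Y_self_adjoint: "p \<in> space (M \<Otimes>\<^sub>M N) \<Longrightarrow> self_adjoint (Y t p)"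
  by (auto simp: Y_def space_pair_measure
      intro!: self_adjoint_add self_adjoint_scaleR m sum.X_self_adjoint gauss.G_self_adjoint)

lemma integrable_norm_X: "integrable (M \<Otimes>\<^sub>M N) (\<lambda>p. norm (X (fst p)))"
  and integrable_norm_G: "integrable (M \<Otimes>\<^sub>M N) (\<lambda>p. norm (G (snd p)))"
  by (intro pair.integrable_fst_snd integrable_norm sum.integrable_X gauss.integrable_norm)+

lemma trace_R_bound: "cmod (trace (R (B :: complex^'d^'d))) \<le> norm (mat 1 :: complex^'d^'d) * sum.\<gamma> TYPE('d)"
  by (rule order_trans[OF norm_trace mult_left_mono[OF sum.norm_R]]) simp

lemma F_has_vector_derivative: "(F has_vector_derivative F' t) (at t)"
proof -
  let ?g = "sum.\<gamma> TYPE('d)" and ?D = "norm (mat 1 :: complex^'d^'d)"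
  define f' where "f' t p = trace (R (Y t p) ** R (Y t p) ** (cos t *\<^sub>R X (fst p) - sin t *\<^sub>R G (snd p)))" for t p
  have "((\<lambda>t. \<integral>p. trace (R (Y t p)) \<partial>(M \<Otimes>\<^sub>M N)) has_vector_derivative (\<integral>p. f' t p \<partial>(M \<Otimes>\<^sub>M N))) (at t)"
  proof (rule has_vector_derivative_integral)
    show "integrable (M \<Otimes>\<^sub>M N) (\<lambda>p. trace (R (Y t p)))" for t
      by (rule pair.integrable_const_bound[OF AE_I2[OF trace_R_bound]]) measurable
    show "f' t \<in> borel_measurable (M \<Otimes>\<^sub>M N)" unfolding f'_def by measurable
    show "integrable (M \<Otimes>\<^sub>M N) (\<lambda>p. ?D * (?g\<^sup>2 * (norm (X (fst p)) + norm (G (snd p)))))"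
      by (intro integrable_mult_right Bochner_Integration.integrable_add integrable_norm_X integrable_norm_G)
    fix t p assume p: "p \<in> space (M \<Otimes>\<^sub>M N)"
    have "((\<lambda>t. Y t p) has_vector_derivative cos t *\<^sub>R X (fst p) - sin t *\<^sub>R G (snd p)) (at t)"
      unfolding Y_def by (auto intro!: derivative_eq_intros)
    hence D: "((\<lambda>t. trace (R (Y t p))) has_vector_derivative
        trace (R (Y t p) ** (cos t *\<^sub>R X (fst p) - sin t *\<^sub>R G (snd p)) ** R (Y t p))) (at t)"
      by (intro bounded_linear.has_vector_derivative[OF bounded_linear_trace] sum.R_has_vector_derivative Y_self_adjoint p)
    have E: "trace (R (Y t p) ** (cos t *\<^sub>R X (fst p) - sin t *\<^sub>R G (snd p)) ** R (Y t p)) = f' t p"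
      unfolding f'_def by (subst trace_mul_sym) (simp add: matrix_mul_assoc)
    show "((\<lambda>t. trace (R (Y t p))) has_vector_derivative f' t p) (at t)"
      using D unfolding E .
    have "norm (cos t *\<^sub>R X (fst p) - sin t *\<^sub>R G (snd p)) \<le> norm (X (fst p)) + norm (G (snd p))"
      by (intro norm_triangle_le_diff add_mono) (simp_all add: mult_left_le_one_le)
    thus "norm (f' t p) \<le> ?D * (?g\<^sup>2 * (norm (X (fst p)) + norm (G (snd p))))"
      unfolding f'_def
      by (intro order_trans[OF sum.trace_R_products_bound(1)] mult_left_mono) auto
  qed
  thus ?thesis unfolding F_def[abs_def] F'_def f'_def .
qed

lemma F'_bound:
  assumes t: "0 \<le> sin t" "0 \<le> cos t"
  shows "cmod (F' t) \<le> 9 * L * sum.\<beta> ^ 4 * sum.total_variance * ((sin t)\<^sup>2 * cos t)"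
proof -
  let ?g = "sum.\<gamma> TYPE('d)" and ?D = "norm (mat 1 :: complex^'d^'d)" and ?P = "M \<Otimes>\<^sub>M N"
  define hX where "hX p = trace (R (Y t p) ** R (Y t p) ** X (fst p))" for p
  define hG where "hG p = trace (R (Y t p) ** R (Y t p) ** G (snd p))" for p
  define Q where "Q p = sum.quad (R (Y t p))" for p
  have [measurable]: "hX \<in> borel_measurable ?P" "hG \<in> borel_measurable ?P" "Q \<in> borel_measurable ?P"
    unfolding hX_def hG_def Q_def by measurable
  have X_int: "integrable ?P hX"
  proof (rule Bochner_Integration.integrable_bound)
    show "integrable ?P (\<lambda>p. ?D * (?g\<^sup>2 * norm (X (fst p))))" by (intro integrable_mult_right integrable_norm_X)
    show "AE p in ?P. norm (hX p) \<le> norm (?D * (?g\<^sup>2 * norm (X (fst p))))"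
      unfolding hX_def by (intro AE_I2 order_trans[OF sum.trace_R_products_bound(1)]) simp
  qed simp
  have G_int: "integrable ?P hG"
  proof (rule Bochner_Integration.integrable_bound)
    show "integrable ?P (\<lambda>p. ?D * (?g\<^sup>2 * norm (G (snd p))))" by (intro integrable_mult_right integrable_norm_G)
    show "AE p in ?P. norm (hG p) \<le> norm (?D * (?g\<^sup>2 * norm (G (snd p))))"
      unfolding hG_def by (intro AE_I2 order_trans[OF sum.trace_R_products_bound(1)]) simp
  qed simp
  have Q_int: "integrable ?P Q"
    unfolding Q_def by (rule pair.integrable_const_bound[OF AE_I2[OF sum.quad_R_bound]]) measurable
  have "(\<integral>p. hG p \<partial>?P) = (\<integral>x. (\<integral>y. hG (x, y) \<partial>N) \<partial>M)"
    using pair.integral_fst'[OF G_int] by simp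
  also have "\<dots> = (\<integral>x. 2 * cos t * (\<integral>y. Q (x, y) \<partial>N) \<partial>M)"
  \<comment> \<open>The sample of \<open>X\<close> is frozen and absorbed into the deterministic
    shift, so that integration by parts acts on \<open>G\<close> alone.\<close>
  proof (rule Bochner_Integration.integral_cong[OF refl])
    fix x assume "x \<in> space M"
    hence "self_adjoint (m + sin t *\<^sub>R X x)"
      by (intro self_adjoint_add self_adjoint_scaleR m sum.X_self_adjoint)
    from gauss.gaussian_integration_by_parts[OF this, of "cos t"]
    show "(\<integral>y. hG (x, y) \<partial>N) = 2 * cos t * (\<integral>y. Q (x, y) \<partial>N)"
      by (simp add: hG_def Q_def Y_def quad_gaussian)
  qed
  also have "\<dots> = 2 * cos t * (\<integral>p. Q p \<partial>?P)"
    using pair.integral_fst'[OF Q_int] by simp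
  finally have Gs: "(\<integral>p. hG p \<partial>?P) = 2 * cos t * (\<integral>p. Q p \<partial>?P)" .
  define h where "h p = hX p - 2 * sin t * Q p" for p
  have h_int: "integrable ?P h"
    unfolding h_def by (intro Bochner_Integration.integrable_diff integrable_mult_right X_int Q_int)
  have "cmod ((\<integral>p. hX p \<partial>?P) - 2 * sin t * (\<integral>p. Q p \<partial>?P)) = cmod (\<integral>p. h p \<partial>?P)"
    unfolding h_def using X_int Q_int by simp
  \<comment> \<open>Now the order is reversed: \<open>G\<close> is frozen in the shift, and the
    leave-one-out estimate is applied on the space of the summands.\<close>
  also have "(\<integral>p. h p \<partial>?P) = (\<integral>y. (\<integral>x. h (x, y) \<partial>M) \<partial>N)"
    using pair.integral_snd[of "\<lambda>x y. h (x, y)"] h_int by simp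
  also have "cmod \<dots> \<le> (\<integral>y. 9 * (sin t)\<^sup>2 * L * sum.\<beta> ^ 4 * sum.total_variance \<partial>N)"
  proof (rule norm_integral_le_AE)
    show "integrable N (\<lambda>y. \<integral>x. h (x, y) \<partial>M)"
      using pair.integrable_snd[of "\<lambda>x y. h (x, y)"] h_int by simp
    \<comment> \<open>Fubini yields integrable sections only for almost every y, hence the almost
      everywhere form of the bound.\<close>
    have Qx: "AE y in N. integrable M (\<lambda>x. Q (x, y))" "AE y in N. integrable M (\<lambda>x. hX (x, y))"
      using pair.AE_integrable_snd[of "\<lambda>x y. Q (x, y)"] pair.AE_integrable_snd[of "\<lambda>x y. hX (x, y)"] X_int Q_int by simp_all
    show "AE y in N. cmod (\<integral>x. h (x, y) \<partial>M) \<le> 9 * (sin t)\<^sup>2 * L * sum.\<beta> ^ 4 * sum.total_variance"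
      using Qx AE_space
    proof eventually_elim
      case (elim y)
      hence sa: "self_adjoint (m + cos t *\<^sub>R G y)"
        by (intro self_adjoint_add self_adjoint_scaleR m gauss.G_self_adjoint)
      have "m + cos t *\<^sub>R G y + sin t *\<^sub>R X x = Y t (x, y)" for x by (simp add: Y_def)
      thus ?case
        using sum.sum_step[OF sa t(1)] elim by (simp add: h_def hX_def Q_def)
    qed
  qed simp
  finally have Xs: "cmod ((\<integral>p. hX p \<partial>?P) - 2 * sin t * (\<integral>p. Q p \<partial>?P)) \<le> 9 * (sin t)\<^sup>2 * L * sum.\<beta> ^ 4 * sum.total_variance"
    by (simp add: gauss.prob_space)
  have "F' t = (\<integral>p. cos t * hX p - sin t * hG p \<partial>?P)"
    unfolding F'_def
    by (simp add: hX_def hG_def matrix_mult.diff_right matrix_mult_scaleR_right trace_sub trace_scaleR)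
  also have "\<dots> = cos t * (\<integral>p. hX p \<partial>?P) - sin t * (\<integral>p. hG p \<partial>?P)"
    using X_int G_int by simp
  \<comment> \<open>The cancellation: sin t times 2 cos t \<open>Q\<close> from the Gaussian half is
    exactly cos t times the second order term of the sum.\<close>
  also have "\<dots> = cos t * ((\<integral>p. hX p \<partial>?P) - 2 * sin t * (\<integral>p. Q p \<partial>?P))"
    unfolding Gs by (simp add: algebra_simps)
  also have "cmod \<dots> \<le> cos t * (9 * (sin t)\<^sup>2 * L * sum.\<beta> ^ 4 * sum.total_variance)"
    using mult_left_mono[OF Xs t(2)] t(2) by (simp add: norm_mult)
  finally show ?thesis by (simp add: mult_ac)
qed

lemma F_ends: "F (pi / 2) = (\<integral>\<omega>. trace (R (m + X \<omega>)) \<partial>M)" "F 0 = (\<integral>\<omega>. trace (R (m + G \<omega>)) \<partial>N)"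
proof -
  have i: "integrable (M \<Otimes>\<^sub>M N) (\<lambda>p. trace (R (Y t p)))" for t
    by (rule pair.integrable_const_bound[OF AE_I2[OF trace_R_bound]]) measurable
  show "F (pi / 2) = (\<integral>\<omega>. trace (R (m + X \<omega>)) \<partial>M)"
    unfolding F_def using pair.integral_fst'[OF i[of "pi / 2"]] by (simp add: Y_def gauss.prob_space)
  show "F 0 = (\<integral>\<omega>. trace (R (m + G \<omega>)) \<partial>N)"
    unfolding F_def using pair.integral_fst'[OF i[of 0]] by (simp add: Y_def sum.prob_space)
qed

lemma comparison:
  "cmod ((\<integral>\<omega>. trace (R (m + X \<omega>)) \<partial>M) - (\<integral>\<omega>. trace (R (m + G \<omega>)) \<partial>N))
    \<le> 3 * L * sum.\<beta> ^ 4 * sum.total_variance"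
proof -
  define K where "K = L * sum.\<beta> ^ 4 * sum.total_variance"
  \<comment> \<open>The increment of \<open>F\<close> is compared with that of 3 K sin^3, whose
    derivative 9 K sin^2 cos dominates the norm of \<open>F'\<close>.\<close>
  have "norm (F (pi / 2) - F 0) \<le> 3 * K * (sin (pi / 2)) ^ 3 - 3 * K * (sin 0) ^ 3"
  proof (rule differentiable_bound_general[where f = F and \<phi> = "\<lambda>t. 3 * K * (sin t) ^ 3"])
    show "continuous_on {0..pi/2} F"
      by (intro continuous_at_imp_continuous_on ballI has_vector_derivative_continuous[OF F_has_vector_derivative])
    show "continuous_on {0..pi/2} (\<lambda>t. 3 * K * (sin t) ^ 3)" by (intro continuous_intros)
    fix t :: real assume t: "0 < t" "t < pi / 2"
    show "(F has_vector_derivative F' t) (at t)" by (rule F_has_vector_derivative)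
    show "((\<lambda>t. 3 * K * (sin t) ^ 3) has_vector_derivative 9 * K * ((sin t)\<^sup>2 * cos t)) (at t)"
      unfolding has_real_derivative_iff_has_vector_derivative[symmetric]
      by (auto intro!: derivative_eq_intros)
    have "0 \<le> sin t" "0 \<le> cos t" using t by (auto intro!: sin_ge_zero cos_ge_zero)
    thus "norm (F' t) \<le> 9 * K * ((sin t)\<^sup>2 * cos t)"
      using F'_bound[of t] by (simp add: K_def mult_ac)
  qed simp
  thus ?thesis by (simp add: F_ends K_def mult_ac)
qed

end

section \<open>Conclusion\<close>

lemma self_adjoint_integral:
  assumes "\<And>\<omega>. \<omega> \<in> space M \<Longrightarrow> self_adjoint (H \<omega>)" and int: "integrable M H"
  shows "self_adjoint (\<integral>\<omega>. H \<omega> \<partial>M :: complex^'d^'d)"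
proof -
  have comp: "(\<integral>\<omega>. H \<omega> \<partial>M) $ i $ j = (\<integral>\<omega>. H \<omega> $ i $ j \<partial>M)" for i j
  proof -
    have "bounded_linear (\<lambda>x :: complex^'d^'d. x $ i $ j)"
      by (rule bounded_linear_compose[OF bounded_linear_vec_nth bounded_linear_vec_nth])
    from integral_bounded_linear[OF this int] show ?thesis by simp
  qed
  have "cnj (\<integral>\<omega>. H \<omega> $ j $ i \<partial>M) = (\<integral>\<omega>. H \<omega> $ i $ j \<partial>M)" for i j
  proof -
    have "cnj (\<integral>\<omega>. H \<omega> $ j $ i \<partial>M) = (\<integral>\<omega>. cnj (H \<omega> $ j $ i) \<partial>M)" by simp
    also have "\<dots> = (\<integral>\<omega>. H \<omega> $ i $ j \<partial>M)"
      by (rule Bochner_Integration.integral_cong[OF refl]) (use assms(1) in \<open>simp add: self_adjoint_nth\<close>)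
    finally show ?thesis .
  qed
  thus ?thesis by (simp add: self_adjoint_nth comp)
qed

lemma gaussian_matrix_integrable:
  fixes Z :: "'b \<Rightarrow> complex^'d^'d"
  assumes "prob_space N" "gaussian_matrix N Z"
  shows "integrable N Z"
proof -
  interpret prob_space N by fact
  have "integrable N (\<lambda>\<omega>. b \<bullet> Z \<omega>)" for b
  proof (rule integrable_of_norm_square)
    have g: "gaussian_rv N (\<lambda>\<omega>. b \<bullet> Z \<omega>)" by (rule gaussian_matrix_inner[OF assms(2)])
    thus "(\<lambda>\<omega>. b \<bullet> Z \<omega>) \<in> borel_measurable N" by (simp add: gaussian_rv_def)
    show "integrable N (\<lambda>\<omega>. (norm (b \<bullet> Z \<omega>))\<^sup>2)"
      using gaussian_rv_integrable_square[OF assms(1) g] by simp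
  qed
  hence "integrable N (\<lambda>\<omega>. \<Sum>b\<in>Basis. (b \<bullet> Z \<omega>) *\<^sub>R b)"
    by (intro Bochner_Integration.integrable_sum integrable_scaleR_left)
  thus ?thesis by (simp add: inner_commute[of _ "Z _"] euclidean_representation)
qed

text \<open>With P = Q = 1 the functional becomes trace (H H), so a second moment can be read off
  the tensor. It serves the degenerate case, where a vanishing second moment passes from
  \<open>X\<close> to \<open>G\<close>.\<close>

lemma integral_norm_square_tensor:
  assumes [measurable]: "H \<in> borel_measurable M" and "integrable M (\<lambda>\<omega>. (norm (H \<omega>))\<^sup>2)"
    and "\<And>\<omega>. \<omega> \<in> space M \<Longrightarrow> self_adjoint (H \<omega> :: complex^'d^'d)"
  shows "of_real (\<integral>\<omega>. (norm (H \<omega>))\<^sup>2 \<partial>M) = tensor_trace (mat 1) (mat 1) (\<integral>\<omega>. kronecker (H \<omega>) (H \<omega>) \<partial>M)"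
proof -
  have "tensor_trace (mat 1) (mat 1) (\<integral>\<omega>. kronecker (H \<omega>) (H \<omega>) \<partial>M)
      = (\<integral>\<omega>. tensor_trace (mat 1) (mat 1) (kronecker (H \<omega>) (H \<omega>)) \<partial>M)"
    using assms by (intro integral_bounded_linear[OF bounded_linear_tensor_trace, symmetric]
      integrable_bilinear_square[OF kronecker.bounded_bilinear_axioms])
  also have "\<dots> = (\<integral>\<omega>. of_real ((norm (H \<omega>))\<^sup>2) \<partial>M)"
    by (intro Bochner_Integration.integral_cong refl)
       (simp add: tensor_trace_kronecker trace_square_self_adjoint assms(3))
  also have "\<dots> = of_real (\<integral>\<omega>. (norm (H \<omega>))\<^sup>2 \<partial>M)"
    by (rule integral_complex_of_real)
  finally show ?thesis ..
qed

lemma AE_zero_of_integral_norm_square: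
  assumes "integrable M (\<lambda>\<omega>. (norm (H \<omega>))\<^sup>2)" "(\<integral>\<omega>. (norm (H \<omega>))\<^sup>2 \<partial>M) = 0"
  shows "AE \<omega> in M. H \<omega> = 0"
  using integral_nonneg_eq_0_iff_AE[OF assms(1)] assms(2) by simp

theorem theorem2:
  fixes M :: "'a measure" and N :: "'b measure"
    and S :: "nat \<Rightarrow> 'a \<Rightarrow> complex^'d^'d" and n :: nat
    and X :: "'a \<Rightarrow> complex^'d^'d" and Z :: "'b \<Rightarrow> complex^'d^'d"
    and \<zeta> :: complex
  assumes "prob_space M" and "prob_space N"
    and "prob_space.indep_vars M (\<lambda>_. borel) S {1..n}"
    and "\<And>i \<omega>. i \<in> {1..n} \<Longrightarrow> \<omega> \<in> space M \<Longrightarrow> self_adjoint (S i \<omega>)"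
    and "\<And>i. i \<in> {1..n} \<Longrightarrow> integrable M (S i)"
    and "\<And>i. i \<in> {1..n} \<Longrightarrow> integrable M (\<lambda>\<omega>. centered M (S i) \<omega> ** centered M (S i) \<omega>)"
    and "X = (\<lambda>\<omega>. \<Sum>i=1..n. S i \<omega>)"
    and "\<And>\<omega>. \<omega> \<in> space N \<Longrightarrow> self_adjoint (Z \<omega>)"
    and "gaussian_matrix N Z"
    and "(\<integral>\<omega>. Z \<omega> \<partial>N) = (\<integral>\<omega>. X \<omega> \<partial>M)"
    and "variance_tensor N Z = variance_tensor M X"
    and "\<zeta> \<notin> \<real>"
  shows "ennreal (cmod (cauchy_transform M X \<zeta> - cauchy_transform N Z \<zeta>))
           \<le> 4 * ennreal (matrix_variance M X) * uniform_bound M n S / ennreal (\<bar>Im \<zeta>\<bar> ^ 4)"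
proof -
  interpret M: prob_space M by fact
  interpret N: prob_space N by fact
  interpret res: resolvent \<zeta> by unfold_locales fact
  define I where "I = {1..n}"
  define A where "A i = centered M (S i)" for i
  define G where "G = centered N Z"
  define m where "m = (\<integral>\<omega>. X \<omega> \<partial>M)"
  note S_int = assms(5)[folded I_def]
  have mean_S: "self_adjoint (\<integral>\<omega>. S i \<omega> \<partial>M)" if "i \<in> I" for i
    using that assms(4,5) unfolding I_def by (intro self_adjoint_integral)
  have A_sa: "self_adjoint (A i \<omega>)" if "i \<in> I" "\<omega> \<in> space M" for i \<omega>
    unfolding A_def centered_def using that assms(4) mean_S by (intro self_adjoint_diff) (auto simp: I_def)
  \<comment> \<open>For self-adjoint matrices the trace of the integrable centered square is the
    squared Frobenius norm, which provides all second moments.\<close>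
  have A_sq: "integrable M (\<lambda>\<omega>. (norm (A i \<omega>))\<^sup>2)" if i: "i \<in> I" for i
  proof -
    have "integrable M (\<lambda>\<omega>. Re (trace (A i \<omega> ** A i \<omega>)))"
      using assms(6) i unfolding I_def A_def
      by (intro integrable_Re integrable_bounded_linear[OF bounded_linear_trace])
    thus ?thesis
      by (rule Bochner_Integration.integrable_cong[OF refl, THEN iffD1, rotated])
         (simp add: trace_square_self_adjoint A_sa i)
  qed
  have "M.indep_vars (\<lambda>_. borel) (\<lambda>i \<omega>. S i \<omega> - (\<integral>\<omega>'. S i \<omega>' \<partial>M)) I"
    unfolding I_def by (rule M.indep_vars_compose2[OF assms(3)]) simp
  hence A_indep: "M.indep_vars (\<lambda>_. borel) A I"
    unfolding A_def[abs_def] centered_def[abs_def] .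
  interpret A: independent_sum M A I
  proof
    show "(\<integral>\<omega>. A i \<omega> \<partial>M) = 0" if "i \<in> I" for i
      using S_int[OF that] by (simp add: A_def centered_def M.prob_space)
    show "finite I" by (simp add: I_def)
  qed (fact A_indep A_sq A_sa)+
  have m_sum: "m = (\<Sum>i\<in>I. \<integral>\<omega>. S i \<omega> \<partial>M)"
    unfolding m_def assms(7) using assms(5) by (simp add: I_def)
  have X_eq: "centered M X = A.X"
  proof
    fix \<omega>
    have "A.X \<omega> = X \<omega> - m"
      unfolding A.X_def A_def centered_def sum_subtractf m_sum assms(7) by (simp only: I_def)
    thus "centered M X \<omega> = A.X \<omega>" by (simp only: centered_def m_def)
  qed
  have m_X: "m + A.X \<omega> = X \<omega>" for \<omega>
    unfolding X_eq[symmetric] by (simp add: centered_def m_def)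
  have m_sa: "self_adjoint m" unfolding m_sum by (intro self_adjoint_sum mean_S)
  have m_Z: "(\<integral>\<omega>. Z \<omega> \<partial>N) = m" using assms(10) by (simp add: m_def)
  have m_G: "m + G \<omega> = Z \<omega>" for \<omega> by (simp add: G_def centered_def m_Z)
  have Z_int: "integrable N Z" by (rule gaussian_matrix_integrable[OF assms(2,9)])
  interpret G: centered_gaussian N G
  proof
    show "gaussian_rv N (\<lambda>\<omega>. a \<bullet> G \<omega>)" for a
      using gaussian_rv_diff_const[OF assms(2) gaussian_matrix_inner[OF assms(9), of a], of "a \<bullet> m"]
      by (simp add: G_def centered_def m_Z inner_diff_right)
    show "(\<integral>\<omega>. G \<omega> \<partial>N) = 0"
      using Z_int by (simp add: G_def centered_def N.prob_space)
    show "self_adjoint (G \<omega>)" if "\<omega> \<in> space N" for \<omega>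
      unfolding G_def centered_def m_Z using assms(8) that m_sa by (intro self_adjoint_diff)
  qed
  have tensors: "(\<integral>\<omega>. kronecker (G \<omega>) (G \<omega>) \<partial>N) = (\<integral>\<omega>. kronecker (A.X \<omega>) (A.X \<omega>) \<partial>M)"
    using assms(11) by (simp add: variance_tensor_def X_eq G_def)
  have X_sa: "self_adjoint (X \<omega>)" if "\<omega> \<in> space M" for \<omega>
    unfolding m_X[symmetric] using that by (intro self_adjoint_add m_sa A.X_self_adjoint)
  have cX: "cauchy_transform M X \<zeta> = (\<integral>\<omega>. trace (res.R (m + A.X \<omega>)) \<partial>M) / of_nat CARD('d)"
    unfolding cauchy_transform_def normalized_trace_def integral_divide_zero m_X
    by (intro arg_cong[where f = "\<lambda>x. x / _"] Bochner_Integration.integral_cong refl) (simp add: res.R_self_adjoint X_sa)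
  have cZ: "cauchy_transform N Z \<zeta> = (\<integral>\<omega>. trace (res.R (m + G \<omega>)) \<partial>N) / of_nat CARD('d)"
    unfolding cauchy_transform_def normalized_trace_def integral_divide_zero m_G
    by (intro arg_cong[where f = "\<lambda>x. x / _"] Bochner_Integration.integral_cong refl) (simp add: res.R_self_adjoint assms(8))
  have mv: "matrix_variance M X = spectral_norm (\<integral>\<omega>. A.X \<omega> ** A.X \<omega> \<partial>M)"
    by (simp add: matrix_variance_def X_eq)
  have tv0: "0 \<le> A.total_variance" by (simp add: A.total_variance_def sum_nonneg)
  \<comment> \<open>The trace is bounded by d times the spectral norm only after summing over i, so
    the result involves the norm of the summed variance and not a sum of norms.\<close>
  have tv: "A.total_variance \<le> real CARD('d) * matrix_variance M X"
    using norm_trace_le_spectral[of "\<integral>\<omega>. A.X \<omega> ** A.X \<omega> \<partial>M"] tv0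
    unfolding mv A.total_variance_eq[symmetric] by simp
  have mv0: "0 \<le> matrix_variance M X" unfolding mv by (rule spectral_norm_nonneg)
  show ?thesis
  proof (cases "uniform_bound M n S = \<infinity>")
    case False
    define L where "L = enn2real (uniform_bound M n S)"
    have L: "uniform_bound M n S = ennreal L" "0 \<le> L"
      using False by (simp_all add: L_def ennreal_enn2real_if)
    interpret gaussian_comparison M A I \<zeta> L N G m
    proof unfold_locales
      fix i assume i: "i \<in> I"
      have "AE \<omega> in M. (SUP i\<in>{1..n}. ennreal (spectral_norm (centered M (S i) \<omega>))) \<le> ennreal L"
        unfolding L(1)[symmetric] uniform_bound_def by (rule esssup_AE)
      thus "AE \<omega> in M. spectral_norm (A i \<omega>) \<le> L"
      proof eventually_elim
        case (elim \<omega>)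
        have "ennreal (spectral_norm (A i \<omega>)) \<le> (SUP i\<in>{1..n}. ennreal (spectral_norm (centered M (S i) \<omega>)))"
          unfolding A_def using i by (intro SUP_upper) (simp add: I_def)
        from order_trans[OF this elim] show ?case using L(2) by (simp add: ennreal_le_iff)
      qed
    qed (fact m_sa tensors)+
    define d where "d = real CARD('d)"
    have d: "d > 0" by (simp add: d_def)
    have "cmod (cauchy_transform M X \<zeta> - cauchy_transform N Z \<zeta>)
        = cmod ((\<integral>\<omega>. trace (res.R (m + A.X \<omega>)) \<partial>M) - (\<integral>\<omega>. trace (res.R (m + G \<omega>)) \<partial>N)) / d"
      unfolding cX cZ diff_divide_distrib[symmetric] norm_divide by (simp add: d_def)
    also have "\<dots> \<le> (3 * L * res.\<beta> ^ 4 * A.total_variance) / d"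
      using d by (intro divide_right_mono comparison) simp
    \<comment> \<open>The factor d from bounding the trace meets the 1/d of the normalized
      trace.\<close>
    also have "\<dots> \<le> (3 * L * res.\<beta> ^ 4 * (d * matrix_variance M X)) / d"
    proof (intro divide_right_mono mult_left_mono)
      show "A.total_variance \<le> d * matrix_variance M X" using tv by (simp add: d_def)
      show "0 \<le> 3 * L * res.\<beta> ^ 4" using L(2) by simp
    qed (use d in simp)
    also have "\<dots> = 3 * (L * res.\<beta> ^ 4 * matrix_variance M X)"
      using d by simp
    also have "\<dots> \<le> 4 * (L * res.\<beta> ^ 4 * matrix_variance M X)"
      using L(2) mv0 by (intro mult_right_mono mult_nonneg_nonneg) simp_all
    also have "\<dots> = 4 * matrix_variance M X * L / \<bar>Im \<zeta>\<bar> ^ 4"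
      by (simp add: res.\<beta>_def power_divide mult_ac)
    finally have "ennreal (cmod (cauchy_transform M X \<zeta> - cauchy_transform N Z \<zeta>))
        \<le> ennreal (4 * matrix_variance M X * L / \<bar>Im \<zeta>\<bar> ^ 4)"
      by (rule ennreal_leI)
    also have "\<dots> = 4 * ennreal (matrix_variance M X) * ennreal L / ennreal (\<bar>Im \<zeta>\<bar> ^ 4)"
      using res.Im_pos L(2) mv0 by (simp add: divide_ennreal[symmetric] ennreal_mult)
    finally show ?thesis unfolding L(1) .
  next
    case True
    show ?thesis
    \<comment> \<open>With an infinite uniform bound the right-hand side is infinite unless the
      variance is 0. In that case 0 times infinity is 0 in \<open>ennreal\<close>, so equality of
      the transforms must be shown: both matrices are almost surely their common mean.\<close>
    proof (cases "matrix_variance M X = 0")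
      case False
      hence "4 * ennreal (matrix_variance M X) * uniform_bound M n S / ennreal (\<bar>Im \<zeta>\<bar> ^ 4) = \<infinity>"
        using mv0 True by (simp add: ennreal_mult_eq_top_iff ennreal_top_mult ennreal_mult_top ennreal_divide_eq_top_iff ennreal_top_divide)
      thus ?thesis by simp
    next
      case zero: True
      have tvz: "A.total_variance = 0" using tv tv0 zero by simp
      have X0: "AE \<omega> in M. A.X \<omega> = 0"
        using A.integrable_X_bilinear[OF bounded_bilinear_inner] A.integral_norm_sq_X tvz
        by (intro AE_zero_of_integral_norm_square) (auto simp: power2_norm_eq_inner)
      have "of_real (\<integral>\<omega>. (norm (G \<omega>))\<^sup>2 \<partial>N) = tensor_trace (mat 1) (mat 1) (\<integral>\<omega>. kronecker (A.X \<omega>) (A.X \<omega>) \<partial>M)"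
        unfolding tensors[symmetric]
        by (intro integral_norm_square_tensor G.integrable_norm_sq G.G_self_adjoint) simp_all
      also have "\<dots> = of_real (\<integral>\<omega>. (norm (A.X \<omega>))\<^sup>2 \<partial>M)"
        using A.integrable_X_bilinear[OF bounded_bilinear_inner]
        by (intro integral_norm_square_tensor[symmetric] A.X_self_adjoint) (simp_all add: power2_norm_eq_inner)
      finally have "(\<integral>\<omega>. (norm (G \<omega>))\<^sup>2 \<partial>N) = 0"
        unfolding of_real_eq_iff A.integral_norm_sq_X tvz .
      hence G0: "AE \<omega> in N. G \<omega> = 0"
        by (intro AE_zero_of_integral_norm_square G.integrable_norm_sq)
      have "(\<integral>\<omega>. trace (res.R (m + A.X \<omega>)) \<partial>M) = (\<integral>\<omega>. trace (res.R m) \<partial>M)"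
      proof (rule integral_cong_AE)
        show "AE \<omega> in M. trace (res.R (m + A.X \<omega>)) = trace (res.R m)" using X0 by eventually_elim simp
      qed measurable
      moreover have "(\<integral>\<omega>. trace (res.R (m + G \<omega>)) \<partial>N) = (\<integral>\<omega>. trace (res.R m) \<partial>N)"
      proof (rule integral_cong_AE)
        show "AE \<omega> in N. trace (res.R (m + G \<omega>)) = trace (res.R m)" using G0 by eventually_elim simp
      qed measurable
      ultimately show ?thesis by (simp add: cX cZ M.prob_space N.prob_space)
    qed
  qed
qed

end
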